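(* Let $\lambda>0$, let $N\ge 1$ be an integer, $\Delta t>0$, $T=N\Delta t$, and suppose that for every $0\le n\le N-1$ the pair $\boldsymbol{\eta}^{n+1},\dot{\boldsymbol{\eta}}^{n+1}$ solves the solid sub-problem (S) on $[t_n,t_{n+1}]$ and the pair $\boldsymbol{u}^{n+1},p^{n+1}$ solves the fluid sub-problem (F) on $[t_n,t_{n+1}]$ (both sub-problems and the initialization are specified in the context, together with the standing regularity assumptions). Define, with $\|\cdot\|_S$ as in the context, $$\mathbf{E}^{n}:=\frac{\rho_f}{2}\|\boldsymbol{u}^n(t_n)\|^2_{L^2(\Omega_f)}+\frac{\rho_s}{2}\|\dot{\boldsymbol{\eta}}^n(t_n)\|^2_{L^2(\Omega_s)}+\frac12\|\boldsymbol{\eta}^n(t_n)\|_S^2\qquad(0\le n\le N),$$ $$\mathbf{T}^{n}:=2\mu\int_{t_{n-1}}^{t_n}\|\varepsilon(\boldsymbol{u}^n)(s)\|^2_{L^2(\Omega_f)}\,ds+\frac{\lambda}{2}\int_{t_{n-1}}^{t_n}\|\dot{\boldsymbol{\eta}}^n(s)-\tilde{\boldsymbol{u}}^{n-1}\|^2_{L^2(\Sigma)}\,ds\qquad(1\le n\le N),$$ $$\mathbf{S}^{n}:=\frac{1}{2\lambda}\int_{t_{n-1}}^{t_n}\|\sigma_f^n(s)\boldsymbol{n}\|^2_{L^2(\Sigma)}\,ds+\frac{\lambda}{2}\int_{t_{n-1}}^{t_n}\|\boldsymbol{u}^n(s)\|^2_{L^2(\Sigma)}\,ds\qquad(1\le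 n\le N),$$ $$\mathbf{S}^{0}:=\frac{\Delta t}{2\lambda}\|\sigma_{\mathcal F}(t_0)\boldsymbol{n}\|^2_{L^2(\Sigma)}+\frac{\lambda\Delta t}{2}\|\boldsymbol{\mathcal U}(t_0)\|^2_{L^2(\Sigma)}.$$ Then $$\mathbf{E}^{N}+\sum_{n=1}^{N}\mathbf{T}^{n}+\mathbf{S}^{N}\le \mathbf{E}^{0}+\mathbf{S}^{0}.$$
   Context: Domains. $\Omega_s$ (solid) and $\Omega_f$ (fluid) are two spatial domains with matching interface $\Sigma=\partial\Omega_s\cap\partial\Omega_f$; $\Sigma_i=\partial\Omega_i\setminus\Sigma$ for $i=s,f$. $\boldsymbol n$ and $\boldsymbol n_s$ are the outward unit normals of $\Omega_f$ and $\Omega_s$, respectively (so $\boldsymbol n_s=-\boldsymbol n$ on $\Sigma$). Constants: densities $\rho_f,\rho_s>0$, viscosity $\mu>0$, Lamé constants $L_1>0$, $L_2\ge 0$. $\varepsilon(\cdot)$ is the symmetric gradient, $\mathbf I$ the identity matrix. $\|\boldsymbol w\|_S^2:=2L_1\|\varepsilon(\boldsymbol w)\|^2_{L^2(\Omega_s)}+L_2\|\mathrm{div}\,\boldsymbol w\|^2_{L^2(\Omega_s)}$. Exact coupled problem (used here only to supply initial data). The fluid velocity $\boldsymbol{\mathcal U}$, fluid pressure $\mathcal P$ and solid displacement $\boldsymbol{\mathcal E}$, with stresses $\sigma_{\mathcal F}=2\mu\,\varepsilon(\boldsymbol{\mathcal U})-\mathcal P\,\mathbf I$ and $\sigma_{\mathcal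 S}=2L_1\varepsilon(\boldsymbol{\mathcal E})+L_2(\mathrm{div}\,\boldsymbol{\mathcal E})\mathbf I$, satisfy $\rho_f\partial_t\boldsymbol{\mathcal U}-\mathrm{div}\,\sigma_{\mathcal F}=0$ and $\mathrm{div}\,\boldsymbol{\mathcal U}=0$ in $\Omega_f\times(0,T)$, $\boldsymbol{\mathcal U}=0$ on $\Sigma_f\times(0,T)$; $\rho_s\partial_{tt}\boldsymbol{\mathcal E}-\mathrm{div}\,\sigma_{\mathcal S}=0$ in $\Omega_s\times(0,T)$, $\boldsymbol{\mathcal E}=0$ on $\Sigma_s\times(0,T)$; and on $\Sigma$: $\boldsymbol{\mathcal U}=\partial_t\boldsymbol{\mathcal E}$, $\sigma_{\mathcal S}\boldsymbol n_s+\sigma_{\mathcal F}\boldsymbol n=0$. Splitting method. $t_n=n\Delta t$, $T=N\Delta t$. Initialization: $\boldsymbol\eta^0(\cdot,t_0)=\boldsymbol{\mathcal E}(\cdot,t_0)$, $\dot{\boldsymbol\eta}^0(\cdot,t_0)=\partial_t\boldsymbol{\mathcal E}(\cdot,t_0)$, $\boldsymbol u^0(\cdot,t_0)=\boldsymbol{\mathcal U}(\cdot,t_0)$, $\tilde{\boldsymbol u}^0=\boldsymbol u^0(\cdot,t_0)$, $\tilde\sigma_f^0=\sigma_{\mathcal F}(\cdot,t_0)$ (the initial pressure $\mathcal P(\cdot,t_0)$ is assumed known exactly). For $n\ge 1$: $\tilde{\boldsymbol u}^n(x)=\frac1{\Delta t}\int_{t_{n-1}}^{t_n}\boldsymbol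 u^n(x,s)\,ds$ and $\tilde\sigma_f^n(x)=\frac1{\Delta t}\int_{t_{n-1}}^{t_n}\sigma_f^n(x,s)\,ds$. For $n=0,\dots,N-1$ one solves successively: (S) Solid sub-problem on $[t_n,t_{n+1}]$: $\rho_s\partial_t\dot{\boldsymbol\eta}^{n+1}-\mathrm{div}\,\sigma_s^{n+1}=0$, $\dot{\boldsymbol\eta}^{n+1}=\partial_t\boldsymbol\eta^{n+1}$, $\sigma_s^{n+1}=2L_1\varepsilon(\boldsymbol\eta^{n+1})+L_2(\mathrm{div}\,\boldsymbol\eta^{n+1})\mathbf I$ in $\Omega_s\times[t_n,t_{n+1}]$; $\boldsymbol\eta^{n+1}=0$ on $\Sigma_s\times[t_n,t_{n+1}]$; $\lambda\dot{\boldsymbol\eta}^{n+1}+\sigma_s^{n+1}\boldsymbol n_s=\lambda\tilde{\boldsymbol u}^n-\tilde\sigma_f^n\boldsymbol n$ on $\Sigma\times[t_n,t_{n+1}]$; $\boldsymbol\eta^{n+1}(\cdot,t_n)=\boldsymbol\eta^n(\cdot,t_n)$, $\dot{\boldsymbol\eta}^{n+1}(\cdot,t_n)=\dot{\boldsymbol\eta}^n(\cdot,t_n)$ on $\Omega_s$. (F) Fluid sub-problem on $[t_n,t_{n+1}]$: $\rho_f\partial_t\boldsymbol u^{n+1}-\mathrm{div}\,\sigma_f^{n+1}=0$, $\sigma_f^{n+1}=2\mu\,\varepsilon(\boldsymbol u^{n+1})-p^{n+1}\mathbf I$, $\mathrm{div}\,\boldsymbol u^{n+1}=0$ in $\Omega_f\times[t_n,t_{n+1}]$;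 $\boldsymbol u^{n+1}=0$ on $\Sigma_f\times[t_n,t_{n+1}]$; $\lambda\boldsymbol u^{n+1}+\sigma_f^{n+1}\boldsymbol n=\lambda\dot{\boldsymbol\eta}^{n+1}+\tilde\sigma_f^n\boldsymbol n$ on $\Sigma\times[t_n,t_{n+1}]$; $\boldsymbol u^{n+1}(\cdot,t_n)=\boldsymbol u^n(\cdot,t_n)$ on $\Omega_f$. Standing regularity assumption. The sub-problems (S) and (F) are assumed well posed, with solutions regular enough that $\sigma_f^{n+1}\boldsymbol n$, $\sigma_s^{n+1}\boldsymbol n$, $\boldsymbol u^{n+1}$, $\dot{\boldsymbol\eta}^{n+1}$ all belong to $L^2(t_n,t_{n+1};L^2(\Sigma))$; domains and solutions are understood to be regular enough that the equations can be multiplied by the respective velocities and integrated by parts in space in the usual way, with the kinetic and elastic energies absolutely continuous in time on each $[t_n,t_{n+1}]$. The quantities in $\mathbf E^0,\mathbf S^0$ are understood to be finite. *)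

theory Defs
  imports "HOL-Analysis.Analysis"
begin

section \<open>Surface measure and domains\<close>

text \<open>
  \<open>(diam C / 2) ^ k\<close> times the volume of the \<open>k\<close>-dimensional unit ball is the usual weight; with it
  the \<open>k\<close>-dimensional Hausdorff measure agrees with the surface measure on \<open>k\<close>-dimensional Lipschitz
  surfaces. The empty set is treated separately because \<open>0 ^ 0 = 1\<close>.
\<close>
definition hausdorff_content :: "nat \<Rightarrow> real \<Rightarrow> 'a::metric_space set \<Rightarrow> ennreal" where
  "hausdorff_content k \<delta> A =
     (INF C \<in> {C :: nat \<Rightarrow> 'a set. A \<subseteq> (\<Union>i. C i) \<and> (\<forall>i. bounded (C i) \<and> diameter (C i) \<le> \<delta>)}.
        \<Sum>i. if C i = {} then 0 else ennreal (unit_ball_vol (real k) * (diameter (C i) / 2) ^ k))"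

text \<open>
  The set function below is a metric outer measure, hence countably additive on the Borel sets, so that
  \<^const>\<open>measure_of\<close> really returns a measure with these values.
\<close>
definition hausdorff_measure :: "nat \<Rightarrow> 'a::metric_space measure" where
  "hausdorff_measure k = measure_of UNIV (sets borel) (\<lambda>A. SUP \<delta>\<in>{0<..}. hausdorff_content k \<delta> A)"

definition surface_on :: "(real^'d) set \<Rightarrow> (real^'d) measure" where
  "surface_on B = restrict_space (completion (hausdorff_measure (CARD('d) - 1))) B"

text \<open>
  \<open>\<nu>\<close> is the outward unit normal at \<open>x\<close> when, near \<open>x\<close>, every open cone around \<open>-\<nu>\<close> of opening less
  than a half-space lies in \<open>\<Omega>\<close> and the opposite one lies outside.
\<close>
definition outward_unit_normal :: "(real^'d) set \<Rightarrow> real^'d \<Rightarrow> real^'d \<Rightarrow> bool" where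
  "outward_unit_normal \<Omega> x \<nu> \<longleftrightarrow> norm \<nu> = 1 \<and>
     (\<forall>\<epsilon>>0. \<exists>r>0. \<forall>y. norm (y - x) < r \<longrightarrow>
        ((y - x) \<bullet> \<nu> < - \<epsilon> * norm (y - x) \<longrightarrow> y \<in> \<Omega>) \<and>
        ((y - x) \<bullet> \<nu> > \<epsilon> * norm (y - x) \<longrightarrow> y \<notin> \<Omega>))"

definition outer_normal :: "(real^'d) set \<Rightarrow> real^'d \<Rightarrow> real^'d" where
  "outer_normal \<Omega> x = (THE \<nu>. outward_unit_normal \<Omega> x \<nu>)"

definition C1_field :: "(real^'d \<Rightarrow> real^'d) \<Rightarrow> bool" where
  "C1_field v \<longleftrightarrow> (\<forall>x. v differentiable (at x)) \<and> continuous_on UNIV (\<lambda>x. jacobian v (at x))"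

definition classical_div :: "(real^'d \<Rightarrow> real^'d) \<Rightarrow> real^'d \<Rightarrow> real" where
  "classical_div v x = trace (jacobian v (at x))"

text \<open>Matrix fields are differentiated row by row: \<open>(div S)\<^sub>i = \<Sum>\<^sub>j \<partial>\<^sub>j S\<^sub>i\<^sub>j\<close>.\<close>
definition C1_tensor :: "(real^'d \<Rightarrow> real^'d^'d) \<Rightarrow> bool" where
  "C1_tensor S \<longleftrightarrow> (\<forall>i. C1_field (\<lambda>x. S x $ i))"

definition classical_tensor_div :: "(real^'d \<Rightarrow> real^'d^'d) \<Rightarrow> real^'d \<Rightarrow> real^'d" where
  "classical_tensor_div S x = (\<chi> i. classical_div (\<lambda>y. S y $ i) x)"

definition square_integrable :: "'a measure \<Rightarrow> ('a \<Rightarrow> 'b::euclidean_space) \<Rightarrow> bool" where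
  "square_integrable M f \<longleftrightarrow> f \<in> borel_measurable M \<and> integrable M (\<lambda>x. (norm (f x))\<^sup>2)"

text \<open>
  The squared \<open>L\<^sup>2\<close> norm. On \<open>real^'d^'d\<close> the library norm and inner product are the Frobenius ones.
\<close>
definition L2sq :: "'a measure \<Rightarrow> ('a \<Rightarrow> 'b::euclidean_space) \<Rightarrow> real" where
  "L2sq M f = (\<integral>x. (norm (f x))\<^sup>2 \<partial>M)"

text \<open>
  The regularity demanded of a domain: a boundary of finite area with a unit normal almost everywhere,
  the divergence theorem for fields that are \<open>C\<^sup>1\<close> up to the boundary, and boundedness of the trace
  operator \<open>H\<^sup>1(\<Omega>) \<rightarrow> L\<^sup>2(\<partial>\<Omega>)\<close>. Every bounded Lipschitz domain qualifies.
\<close>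
definition regular_domain :: "(real^'d) set \<Rightarrow> bool" where
  "regular_domain \<Omega> \<longleftrightarrow>
     open \<Omega> \<and> bounded \<Omega> \<and> \<Omega> \<noteq> {} \<and>
     emeasure (surface_on (frontier \<Omega>)) (frontier \<Omega>) < \<infinity> \<and>
     (AE x in surface_on (frontier \<Omega>). \<exists>\<nu>. outward_unit_normal \<Omega> x \<nu>) \<and>
     outer_normal \<Omega> \<in> borel_measurable (surface_on (frontier \<Omega>)) \<and>
     (\<forall>F. C1_field F \<longrightarrow>
        (\<integral>x. classical_div F x \<partial>lebesgue_on \<Omega>) =
        (\<integral>x. F x \<bullet> outer_normal \<Omega> x \<partial>surface_on (frontier \<Omega>))) \<and>
     (\<exists>C. \<forall>v. C1_field v \<longrightarrow>
        L2sq (surface_on (frontier \<Omega>)) v \<le>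
          C * (L2sq (lebesgue_on \<Omega>) v + L2sq (lebesgue_on \<Omega>) (\<lambda>x. jacobian v (at x))))"


section \<open>Weak derivatives and traces\<close>

text \<open>
  Compactly supported \<open>C\<^sup>1\<close> test functions define the same weak derivatives as smooth ones, by
  mollification.
\<close>
definition compact_support_in :: "(real^'d) set \<Rightarrow> (real^'d \<Rightarrow> 'b::zero) \<Rightarrow> bool" where
  "compact_support_in \<Omega> \<phi> \<longleftrightarrow> compact (closure {x. \<phi> x \<noteq> 0}) \<and> closure {x. \<phi> x \<noteq> 0} \<subseteq> \<Omega>"

definition has_weak_grad ::
    "(real^'d) set \<Rightarrow> (real^'d \<Rightarrow> real^'d) \<Rightarrow> (real^'d \<Rightarrow> real^'d^'d) \<Rightarrow> bool" where
  "has_weak_grad \<Omega> v G \<longleftrightarrow>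
     square_integrable (lebesgue_on \<Omega>) v \<and> square_integrable (lebesgue_on \<Omega>) G \<and>
     (\<forall>\<Phi>. C1_tensor \<Phi> \<and> compact_support_in \<Omega> \<Phi> \<longrightarrow>
        (\<integral>x. v x \<bullet> classical_tensor_div \<Phi> x \<partial>lebesgue_on \<Omega>) =
        - (\<integral>x. G x \<bullet> \<Phi> x \<partial>lebesgue_on \<Omega>))"

definition in_H1 :: "(real^'d) set \<Rightarrow> (real^'d \<Rightarrow> real^'d) \<Rightarrow> bool" where
  "in_H1 \<Omega> v \<longleftrightarrow> (\<exists>G. has_weak_grad \<Omega> v G)"

text \<open>Determined almost everywhere in \<open>\<Omega>\<close> for \<open>v\<close> in \<open>H\<^sup>1(\<Omega>)\<close>.\<close>
definition weak_grad :: "(real^'d) set \<Rightarrow> (real^'d \<Rightarrow> real^'d) \<Rightarrow> real^'d \<Rightarrow> real^'d^'d" where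
  "weak_grad \<Omega> v = (SOME G. has_weak_grad \<Omega> v G)"

definition sym_grad :: "(real^'d) set \<Rightarrow> (real^'d \<Rightarrow> real^'d) \<Rightarrow> real^'d \<Rightarrow> real^'d^'d" where
  "sym_grad \<Omega> v x = (1/2) *\<^sub>R (weak_grad \<Omega> v x + transpose (weak_grad \<Omega> v x))"

definition weak_div :: "(real^'d) set \<Rightarrow> (real^'d \<Rightarrow> real^'d) \<Rightarrow> real^'d \<Rightarrow> real" where
  "weak_div \<Omega> v x = trace (weak_grad \<Omega> v x)"

definition has_weak_tensor_div ::
    "(real^'d) set \<Rightarrow> (real^'d \<Rightarrow> real^'d^'d) \<Rightarrow> (real^'d \<Rightarrow> real^'d) \<Rightarrow> bool" where
  "has_weak_tensor_div \<Omega> S f \<longleftrightarrow>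
     square_integrable (lebesgue_on \<Omega>) S \<and> square_integrable (lebesgue_on \<Omega>) f \<and>
     (\<forall>\<phi>. C1_field \<phi> \<and> compact_support_in \<Omega> \<phi> \<longrightarrow>
        (\<integral>x. S x \<bullet> jacobian \<phi> (at x) \<partial>lebesgue_on \<Omega>) = - (\<integral>x. f x \<bullet> \<phi> x \<partial>lebesgue_on \<Omega>))"

definition L2_converges ::
    "'a measure \<Rightarrow> (nat \<Rightarrow> 'a \<Rightarrow> 'b::euclidean_space) \<Rightarrow> ('a \<Rightarrow> 'b) \<Rightarrow> bool" where
  "L2_converges M fs f \<longleftrightarrow>
     (\<forall>k. square_integrable M (fs k)) \<and> square_integrable M f \<and>
     (\<lambda>k. L2sq M (\<lambda>x. fs k x - f x)) \<longlonglongrightarrow> 0"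

text \<open>
  A single function carries both a field on the open set \<open>\<Omega>\<close> and its values on \<open>\<partial>\<Omega>\<close>: the predicate says
  that \<open>v\<close> restricted to \<open>\<Omega>\<close> is in \<open>H\<^sup>1(\<Omega>)\<close> and that \<open>v\<close> restricted to \<open>\<partial>\<Omega>\<close> is its trace.
\<close>
definition H1_with_trace :: "(real^'d) set \<Rightarrow> (real^'d \<Rightarrow> real^'d) \<Rightarrow> bool" where
  "H1_with_trace \<Omega> v \<longleftrightarrow> in_H1 \<Omega> v \<and>
     (\<exists>vs. (\<forall>k. C1_field (vs k)) \<and>
        L2_converges (lebesgue_on \<Omega>) vs v \<and>
        L2_converges (lebesgue_on \<Omega>) (\<lambda>k x. jacobian (vs k) (at x)) (weak_grad \<Omega> v) \<and>
        L2_converges (surface_on (frontier \<Omega>)) vs v)"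

text \<open>
  \<open>S n = \<tau>\<close> on the boundary part \<open>\<Sigma>\<close>, for \<open>S\<close> with weak divergence \<open>f\<close>: the pair is approximated by
  matrix fields that are \<open>C\<^sup>1\<close> up to the boundary, whose pointwise normal components converge
  to \<open>\<tau>\<close> in \<open>L\<^sup>2(\<Sigma>)\<close>.
\<close>
definition has_normal_trace ::
    "(real^'d) set \<Rightarrow> (real^'d) set \<Rightarrow> (real^'d \<Rightarrow> real^'d^'d) \<Rightarrow> (real^'d \<Rightarrow> real^'d) \<Rightarrow>
     (real^'d \<Rightarrow> real^'d) \<Rightarrow> bool" where
  "has_normal_trace \<Omega> \<Sigma> S f \<tau> \<longleftrightarrow>
     (\<exists>Ss. (\<forall>k. C1_tensor (Ss k)) \<and>
        L2_converges (lebesgue_on \<Omega>) Ss S \<and>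
        L2_converges (lebesgue_on \<Omega>) (\<lambda>k. classical_tensor_div (Ss k)) f \<and>
        L2_converges (surface_on \<Sigma>) (\<lambda>k x. Ss k x *v outer_normal \<Omega> x) \<tau>)"


section \<open>Dependence on time\<close>

text \<open>Absolute continuity with respect to the distance \<open>dst\<close>.\<close>
definition abs_continuous ::
    "('b \<Rightarrow> 'b \<Rightarrow> real) \<Rightarrow> real set \<Rightarrow> (real \<Rightarrow> 'b) \<Rightarrow> bool" where
  "abs_continuous dst I f \<longleftrightarrow>
     (\<forall>\<epsilon>>0. \<exists>\<delta>>0. \<forall>\<D>. \<D> division_of \<Union>\<D> \<and> \<Union>\<D> \<subseteq> I \<and> (\<Sum>K\<in>\<D>. Sup K - Inf K) < \<delta> \<longrightarrow>
        (\<Sum>K\<in>\<D>. dst (f (Inf K)) (f (Sup K))) < \<epsilon>)"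

definition L2_dist :: "'a measure \<Rightarrow> ('a \<Rightarrow> 'b::euclidean_space) \<Rightarrow> ('a \<Rightarrow> 'b) \<Rightarrow> real" where
  "L2_dist M f g = sqrt (L2sq M (\<lambda>x. f x - g x))"

text \<open>
  The functions in \<open>C([a,b]; L\<^sup>2) \<inter> W\<^sup>1\<^sup>,\<^sup>1\<^sub>l\<^sub>o\<^sub>c(a,b; L\<^sup>2)\<close>. Their weak time derivative is the \<open>L\<^sup>2\<close> limit of
  difference quotients at almost every time.
\<close>
definition L2_evolution ::
    "'a measure \<Rightarrow> real \<Rightarrow> real \<Rightarrow> (real \<Rightarrow> 'a \<Rightarrow> 'b::euclidean_space) \<Rightarrow> bool" where
  "L2_evolution M a b f \<longleftrightarrow>
     (\<forall>t\<in>{a..b}. square_integrable M (f t) \<and> ((\<lambda>s. L2_dist M (f s) (f t)) \<longlongrightarrow> 0) (at t within {a..b})) \<and>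
     (\<forall>c d. a < c \<and> c \<le> d \<and> d < b \<longrightarrow> abs_continuous (L2_dist M) {c..d} f)"

definition has_L2_deriv ::
    "'a measure \<Rightarrow> (real \<Rightarrow> 'a \<Rightarrow> 'b::euclidean_space) \<Rightarrow> ('a \<Rightarrow> 'b) \<Rightarrow> real filter \<Rightarrow> real \<Rightarrow> bool" where
  "has_L2_deriv M f g F t \<longleftrightarrow> square_integrable M g \<and>
     ((\<lambda>s. L2_dist M (\<lambda>x. (1 / (s - t)) *\<^sub>R (f s x - f t x)) g) \<longlongrightarrow> 0) F"

text \<open>The space \<open>L\<^sup>2(a,b; L\<^sup>2(M))\<close>.\<close>
definition L2_L2 :: "'a measure \<Rightarrow> real \<Rightarrow> real \<Rightarrow> (real \<Rightarrow> 'a \<Rightarrow> 'b::euclidean_space) \<Rightarrow> bool" where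
  "L2_L2 M a b f \<longleftrightarrow> square_integrable (lebesgue_on {a..b} \<Otimes>\<^sub>M M) (\<lambda>(t, x). f t x)"


section \<open>Solid and fluid equations\<close>

definition solid_stress ::
    "real \<Rightarrow> real \<Rightarrow> (real^'d) set \<Rightarrow> (real^'d \<Rightarrow> real^'d) \<Rightarrow> real^'d \<Rightarrow> real^'d^'d" where
  "solid_stress L1 L2 \<Omega> \<eta> x = (2 * L1) *\<^sub>R sym_grad \<Omega> \<eta> x + (L2 * weak_div \<Omega> \<eta> x) *\<^sub>R mat 1"

definition fluid_stress ::
    "real \<Rightarrow> (real^'d) set \<Rightarrow> (real^'d \<Rightarrow> real^'d) \<Rightarrow> (real^'d \<Rightarrow> real) \<Rightarrow> real^'d \<Rightarrow> real^'d^'d" where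
  "fluid_stress \<mu> \<Omega> u p x = (2 * \<mu>) *\<^sub>R sym_grad \<Omega> u x - p x *\<^sub>R mat 1"

definition S_normsq :: "real \<Rightarrow> real \<Rightarrow> (real^'d) set \<Rightarrow> (real^'d \<Rightarrow> real^'d) \<Rightarrow> real" where
  "S_normsq L1 L2 \<Omega> w =
     2 * L1 * L2sq (lebesgue_on \<Omega>) (sym_grad \<Omega> w) + L2 * L2sq (lebesgue_on \<Omega>) (weak_div \<Omega> w)"

text \<open>
  The solid equations on \<open>\<Omega> \<times> [a,b]\<close> with displacement \<open>\<eta>\<close>, velocity \<open>\<eta>d\<close> and interface traction
  \<open>\<tau> = \<sigma>\<^sub>s n\<^sub>s\<close> on \<open>\<Sigma>\<close>. The identity \<open>\<eta>d = \<partial>\<^sub>t \<eta>\<close> is understood in \<open>H\<^sup>1(\<Omega>)\<close>, i.e. for the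
  displacement and for its gradient.
\<close>
definition solid_equations ::
    "(real^'d) set \<Rightarrow> (real^'d) set \<Rightarrow> real \<Rightarrow> real \<Rightarrow> real \<Rightarrow> real \<Rightarrow> real \<Rightarrow>
     (real \<Rightarrow> real^'d \<Rightarrow> real^'d) \<Rightarrow> (real \<Rightarrow> real^'d \<Rightarrow> real^'d) \<Rightarrow> (real \<Rightarrow> real^'d \<Rightarrow> real^'d) \<Rightarrow> bool" where
  "solid_equations \<Omega> \<Sigma> \<rho> L1 L2 a b \<eta> \<eta>d \<tau> \<longleftrightarrow>
     (\<forall>t\<in>{a..b}. H1_with_trace \<Omega> (\<eta> t) \<and> (AE x in surface_on (frontier \<Omega> - \<Sigma>). \<eta> t x = 0)) \<and>
     L2_evolution (lebesgue_on \<Omega>) a b \<eta> \<and>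
     L2_evolution (lebesgue_on \<Omega>) a b (\<lambda>t. weak_grad \<Omega> (\<eta> t)) \<and>
     L2_evolution (lebesgue_on \<Omega>) a b \<eta>d \<and>
     (AE t in lebesgue_on {a..b}.
        H1_with_trace \<Omega> (\<eta>d t) \<and>
        has_L2_deriv (lebesgue_on \<Omega>) \<eta> (\<eta>d t) (at t within {a..b}) t \<and>
        has_L2_deriv (lebesgue_on \<Omega>) (\<lambda>s. weak_grad \<Omega> (\<eta> s)) (weak_grad \<Omega> (\<eta>d t))
          (at t within {a..b}) t \<and>
        (\<exists>acc. has_L2_deriv (lebesgue_on \<Omega>) \<eta>d acc (at t within {a..b}) t \<and>
           has_weak_tensor_div \<Omega> (solid_stress L1 L2 \<Omega> (\<eta> t)) (\<lambda>x. \<rho> *\<^sub>R acc x) \<and>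
           has_normal_trace \<Omega> \<Sigma> (solid_stress L1 L2 \<Omega> (\<eta> t)) (\<lambda>x. \<rho> *\<^sub>R acc x) (\<tau> t)))"

text \<open>
  The fluid equations on \<open>\<Omega> \<times> [a,b]\<close> with velocity \<open>u\<close>, pressure \<open>p\<close> and interface traction
  \<open>\<tau> = \<sigma>\<^sub>f n\<close> on \<open>\<Sigma>\<close>.
\<close>
definition fluid_equations ::
    "(real^'d) set \<Rightarrow> (real^'d) set \<Rightarrow> real \<Rightarrow> real \<Rightarrow> real \<Rightarrow> real \<Rightarrow>
     (real \<Rightarrow> real^'d \<Rightarrow> real^'d) \<Rightarrow> (real \<Rightarrow> real^'d \<Rightarrow> real) \<Rightarrow> (real \<Rightarrow> real^'d \<Rightarrow> real^'d) \<Rightarrow> bool" where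
  "fluid_equations \<Omega> \<Sigma> \<rho> \<mu> a b u p \<tau> \<longleftrightarrow>
     L2_evolution (lebesgue_on \<Omega>) a b u \<and>
     (AE t in lebesgue_on {a..b}.
        H1_with_trace \<Omega> (u t) \<and>
        square_integrable (lebesgue_on \<Omega>) (p t) \<and>
        (AE x in lebesgue_on \<Omega>. weak_div \<Omega> (u t) x = 0) \<and>
        (AE x in surface_on (frontier \<Omega> - \<Sigma>). u t x = 0) \<and>
        (\<exists>acc. has_L2_deriv (lebesgue_on \<Omega>) u acc (at t within {a..b}) t \<and>
           has_weak_tensor_div \<Omega> (fluid_stress \<mu> \<Omega> (u t) (p t)) (\<lambda>x. \<rho> *\<^sub>R acc x) \<and>
           has_normal_trace \<Omega> \<Sigma> (fluid_stress \<mu> \<Omega> (u t) (p t)) (\<lambda>x. \<rho> *\<^sub>R acc x) (\<tau> t)))"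

text \<open>
  The coupled problem on \<open>[0,T]\<close>; \<open>Ed\<close> is the solid velocity, \<open>\<tau>S = \<sigma>\<^sub>S n\<^sub>s\<close> and \<open>\<tau>F = \<sigma>\<^sub>F n\<close>. The last three
  lines say that the trace and the traction of the fluid at time \<open>0\<close> exist in \<open>L\<^sup>2(\<Sigma>)\<close>.
\<close>
definition coupled_solution ::
    "(real^'d) set \<Rightarrow> (real^'d) set \<Rightarrow> real \<Rightarrow> real \<Rightarrow> real \<Rightarrow> real \<Rightarrow> real \<Rightarrow> real \<Rightarrow>
     (real \<Rightarrow> real^'d \<Rightarrow> real^'d) \<Rightarrow> (real \<Rightarrow> real^'d \<Rightarrow> real) \<Rightarrow>
     (real \<Rightarrow> real^'d \<Rightarrow> real^'d) \<Rightarrow> (real \<Rightarrow> real^'d \<Rightarrow> real^'d) \<Rightarrow>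
     (real \<Rightarrow> real^'d \<Rightarrow> real^'d) \<Rightarrow> (real \<Rightarrow> real^'d \<Rightarrow> real^'d) \<Rightarrow> bool" where
  "coupled_solution \<Omega>s \<Omega>f \<rho>s \<rho>f \<mu> L1 L2 T U P E Ed \<tau>S \<tau>F \<longleftrightarrow>
     (let \<Sigma> = frontier \<Omega>s \<inter> frontier \<Omega>f in
        fluid_equations \<Omega>f \<Sigma> \<rho>f \<mu> 0 T U P \<tau>F \<and>
        solid_equations \<Omega>s \<Sigma> \<rho>s L1 L2 0 T E Ed \<tau>S \<and>
        (AE t in lebesgue_on {0..T}. AE x in surface_on \<Sigma>. U t x = Ed t x \<and> \<tau>S t x + \<tau>F t x = 0) \<and>
        H1_with_trace \<Omega>f (U 0) \<and>
        (\<exists>f. has_weak_tensor_div \<Omega>f (fluid_stress \<mu> \<Omega>f (U 0) (P 0)) f \<and>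
             has_normal_trace \<Omega>f \<Sigma> (fluid_stress \<mu> \<Omega>f (U 0) (P 0)) f (\<tau>F 0)))"


section \<open>The splitting method\<close>

text \<open>
  \<open>g 0 0\<close> for \<open>n = 0\<close> and otherwise the mean of \<open>g n\<close> over \<open>[t\<^sub>n\<^sub>-\<^sub>1, t\<^sub>n]\<close>, where \<open>t\<^sub>n = n \<Delta>t\<close>. It is used on the
  interface, for the fluid velocity and for the fluid traction: averaging in time commutes with
  taking the normal component, so the mean of \<open>\<sigma>\<^sub>f n\<close> is the normal component of the mean of \<open>\<sigma>\<^sub>f\<close>.
\<close>
definition slab_mean :: "real \<Rightarrow> (nat \<Rightarrow> real \<Rightarrow> 'a \<Rightarrow> 'b::euclidean_space) \<Rightarrow> nat \<Rightarrow> 'a \<Rightarrow> 'b" where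
  "slab_mean \<Delta>t g n x =
     (if n = 0 then g 0 0 x
      else (1 / \<Delta>t) *\<^sub>R (\<integral>s. g n s x \<partial>lebesgue_on {(real n - 1) * \<Delta>t .. real n * \<Delta>t}))"

text \<open>
  Sub-problem (S) on \<open>[a,b]\<close>, with interface data \<open>um\<close>, \<open>\<tau>m\<close> (the averaged fluid velocity and traction)
  and initial state \<open>\<eta>0\<close>, \<open>\<eta>d0\<close>, together with the assumed regularity of its solution.
\<close>
definition solid_subproblem ::
    "(real^'d) set \<Rightarrow> (real^'d) set \<Rightarrow> real \<Rightarrow> real \<Rightarrow> real \<Rightarrow> real \<Rightarrow> real \<Rightarrow> real \<Rightarrow>
     (real^'d \<Rightarrow> real^'d) \<Rightarrow> (real^'d \<Rightarrow> real^'d) \<Rightarrow> (real^'d \<Rightarrow> real^'d) \<Rightarrow> (real^'d \<Rightarrow> real^'d) \<Rightarrow>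
     (real \<Rightarrow> real^'d \<Rightarrow> real^'d) \<Rightarrow> (real \<Rightarrow> real^'d \<Rightarrow> real^'d) \<Rightarrow> (real \<Rightarrow> real^'d \<Rightarrow> real^'d) \<Rightarrow> bool" where
  "solid_subproblem \<Omega> \<Sigma> \<rho> L1 L2 lam a b um \<tau>m \<eta>0 \<eta>d0 \<eta> \<eta>d \<tau> \<longleftrightarrow>
     solid_equations \<Omega> \<Sigma> \<rho> L1 L2 a b \<eta> \<eta>d \<tau> \<and>
     (AE t in lebesgue_on {a..b}. AE x in surface_on \<Sigma>.
        lam *\<^sub>R \<eta>d t x + \<tau> t x = lam *\<^sub>R um x - \<tau>m x) \<and>
     (AE x in lebesgue_on \<Omega>. \<eta> a x = \<eta>0 x) \<and>
     (AE x in lebesgue_on \<Omega>. \<eta>d a x = \<eta>d0 x) \<and>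
     L2_L2 (surface_on \<Sigma>) a b \<eta>d \<and>
     L2_L2 (surface_on \<Sigma>) a b \<tau> \<and>
     abs_continuous dist {a..b} (\<lambda>t. \<rho> / 2 * L2sq (lebesgue_on \<Omega>) (\<eta>d t)) \<and>
     abs_continuous dist {a..b} (\<lambda>t. 1 / 2 * S_normsq L1 L2 \<Omega> (\<eta> t))"

text \<open>
  Sub-problem (F) on \<open>[a,b]\<close>, with interface data \<open>w\<close> (the new solid velocity) and \<open>\<tau>m\<close> (the averaged
  fluid traction) and initial velocity \<open>u0\<close>, together with the assumed regularity of its solution.
\<close>
definition fluid_subproblem ::
    "(real^'d) set \<Rightarrow> (real^'d) set \<Rightarrow> real \<Rightarrow> real \<Rightarrow> real \<Rightarrow> real \<Rightarrow> real \<Rightarrow>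
     (real \<Rightarrow> real^'d \<Rightarrow> real^'d) \<Rightarrow> (real^'d \<Rightarrow> real^'d) \<Rightarrow> (real^'d \<Rightarrow> real^'d) \<Rightarrow>
     (real \<Rightarrow> real^'d \<Rightarrow> real^'d) \<Rightarrow> (real \<Rightarrow> real^'d \<Rightarrow> real) \<Rightarrow> (real \<Rightarrow> real^'d \<Rightarrow> real^'d) \<Rightarrow> bool" where
  "fluid_subproblem \<Omega> \<Sigma> \<rho> \<mu> lam a b w \<tau>m u0 u p \<tau> \<longleftrightarrow>
     fluid_equations \<Omega> \<Sigma> \<rho> \<mu> a b u p \<tau> \<and>
     (AE t in lebesgue_on {a..b}. AE x in surface_on \<Sigma>.
        lam *\<^sub>R u t x + \<tau> t x = lam *\<^sub>R w t x + \<tau>m x) \<and>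
     (AE x in lebesgue_on \<Omega>. u a x = u0 x) \<and>
     L2_L2 (surface_on \<Sigma>) a b u \<and>
     L2_L2 (surface_on \<Sigma>) a b \<tau> \<and>
     integrable (lebesgue_on {a..b}) (\<lambda>t. L2sq (lebesgue_on \<Omega>) (sym_grad \<Omega> (u t))) \<and>
     abs_continuous dist {a..b} (\<lambda>t. \<rho> / 2 * L2sq (lebesgue_on \<Omega>) (u t))"

end

theory Submission
  imports Defs
begin

text \<open>
  Testing each sub-problem with its own velocity turns it into an energy balance over the time slab
  whose only source is the power of the traction on the interface. Let \<open>um\<close>, \<open>\<tau>m\<close> be the averages
  of \<open>u\<close>, \<open>\<tau>f\<close> over the previous slab. The two Robin conditions turn the sum of the two powers into
  the exact difference
  \<open>\<lambda>/2 (|um|\<^sup>2 - |u|\<^sup>2 - |\<eta>d - um|\<^sup>2) + 1/(2\<lambda>) (|\<tau>m|\<^sup>2 - |\<tau>f|\<^sup>2)\<close>.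
  By Jensen's inequality the terms in \<open>um\<close> and \<open>\<tau>m\<close> contribute at most \<open>S n\<close>, so that
  \<open>E (n+1) + T (n+1) + S (n+1) \<le> E n + S n\<close>, which is summed over \<open>n\<close>.
\<close>

section \<open>Absolutely continuous functions\<close>

text \<open>The algebra takes a few lines; what shapes the proof is the low regularity. In time, the
  energies are absolutely continuous and differentiable only almost everywhere, so each balance is
  an identity of derivatives at almost every time followed by a fundamental theorem for absolutely
  continuous functions. In space, the tractions are known only on \<open>\<Sigma>\<close>, as limits
  of smooth ones, and the solid is clamped through its displacement while the test field is its
  velocity; that the velocity vanishes off \<open>\<Sigma>\<close> has to be recovered from the
  trace inequality. Successive slabs, interface conditions and initial data match only almost
  everywhere, so completeness of the measures carries the transfers.

  No inequality enters before the averages are bounded: within a slab the balance is exact because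
  the fluid condition uses the solid velocity at each instant, while the data inherited from the
  previous slab are constant in time. \<open>S n\<close> is the quantity that controls these data,
  and \<open>S0\<close> plays that role for the exact initial values.\<close>

lemma abs_continuous_add:
  fixes f g :: "real \<Rightarrow> real"
  assumes "abs_continuous dist I f" "abs_continuous dist I g"
  shows "abs_continuous dist I (\<lambda>t. f t + g t)"
  unfolding abs_continuous_def
proof (intro allI impI)
  fix e :: real assume "e > 0"
  then have "e/2 > 0" by simp
  from assms(1)[unfolded abs_continuous_def, rule_format, OF this]
  obtain d1 where d1: "d1 > 0" "\<And>\<D>. \<D> division_of \<Union>\<D> \<and> \<Union>\<D>
    \<subseteq> I \<and> (\<Sum>K\<in>\<D>. Sup K - Inf K) < d1 \<Longrightarrow>
        (\<Sum>K\<in>\<D>. dist (f (Inf K)) (f (Sup K))) < e/2" by blast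
  from assms(2)[unfolded abs_continuous_def, rule_format, OF \<open>e/2>0\<close>]
  obtain d2 where d2: "d2 > 0" "\<And>\<D>. \<D> division_of \<Union>\<D> \<and> \<Union>\<D>
    \<subseteq> I \<and> (\<Sum>K\<in>\<D>. Sup K - Inf K) < d2 \<Longrightarrow>
        (\<Sum>K\<in>\<D>. dist (g (Inf K)) (g (Sup K))) < e/2" by blast
  show "\<exists>\<delta>>0. \<forall>\<D>. \<D> division_of \<Union>\<D> \<and> \<Union>\<D>
    \<subseteq> I \<and> (\<Sum>K\<in>\<D>. Sup K - Inf K) < \<delta> \<longrightarrow>
        (\<Sum>K\<in>\<D>. dist (f (Inf K) + g (Inf K)) (f (Sup K) + g (Sup K))) < e"
  proof (intro exI[of _ "min d1 d2"] conjI allI impI)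
    show "0 < min d1 d2" using d1 d2 by simp
    fix \<D> assume D: "\<D> division_of \<Union>\<D> \<and> \<Union>\<D> \<subseteq> I \<and>
      (\<Sum>K\<in>\<D>. Sup K - Inf K) < min d1 d2"
    have "(\<Sum>K\<in>\<D>. dist (f (Inf K) + g (Inf K)) (f (Sup K) + g (Sup K)))
      \<le> (\<Sum>K\<in>\<D>. dist (f (Inf K)) (f (Sup K)) + dist (g (Inf K)) (g (Sup K)))"
      by (intro sum_mono dist_triangle_add)
    also have "\<dots> < e" using d1(2)[of \<D>] d2(2)[of \<D>] D by (simp add: sum.distrib)
    finally show "(\<Sum>K\<in>\<D>. dist (f (Inf K) + g (Inf K)) (f (Sup K) + g (Sup K))) < e" .
  qed
qed

text \<open>
  The gauge is given by the derivative off \<open>Z\<close>; on \<open>Z\<close> it keeps the intervals inside an open set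
  so small that absolute continuity controls the increments of \<open>f\<close> there.
\<close>
lemma abs_continuous_has_integral:
  fixes f g :: "real \<Rightarrow> real"
  assumes "a \<le> b" and ac: "abs_continuous dist {a..b} f" and Z: "negligible Z"
    and deriv: "\<And>t. t \<in> {a..b} - Z \<Longrightarrow> (f has_real_derivative g t) (at t within
      {a..b})"
    and g0: "\<And>t. t \<in> Z \<Longrightarrow> g t = 0"
  shows "(g has_integral f b - f a) {a..b}"
  unfolding has_integral box_real[symmetric]
proof (intro allI impI)
  fix e :: real assume "e > 0"
  \<comment> \<open>The \<open>+ 1\<close> keeps the quotient meaningful for \<open>a = b\<close>
    and leaves \<open>e1 * (b - a)\<close> strictly below \<open>e/2\<close>.\<close>
  define e1 where "e1 = e / (2 * (b - a + 1))"
  have e1: "e1 > 0" "e1 * (b - a) < e/2" using \<open>e > 0\<close> \<open>a \<le> b\<close> by (auto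
    simp: e1_def field_simps)
  obtain \<delta> where \<delta>: "\<delta> > 0" "\<And>\<D>. \<D> division_of \<Union>\<D>
    \<Longrightarrow> \<Union>\<D> \<subseteq> {a..b} \<Longrightarrow> (\<Sum>K\<in>\<D>. Sup K - Inf
      K) < \<delta> \<Longrightarrow>
        (\<Sum>K\<in>\<D>. dist (f (Inf K)) (f (Sup K))) < e/2"
    using ac[unfolded abs_continuous_def, rule_format, of "e/2"] \<open>e > 0\<close> by auto
  have Zs: "Z \<in> sets lebesgue" "Z \<in> null_sets lebesgue" using Z
    by (simp_all add: negligible_imp_sets negligible_iff_null_sets)
  \<comment> \<open>\<open>Z\<close> has measure zero, so it lies in an open set of measure below
    the \<open>\<delta>\<close> of absolute continuity; non-overlapping intervals inside
    \<open>T\<close> then have total length below \<open>\<delta>\<close>.\<close>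
  obtain T where T: "open T" "Z \<subseteq> T" "T - Z \<in> lmeasurable" "emeasure lebesgue (T - Z) <
    ennreal \<delta>"
    using sets_lebesgue_outer_open[OF Zs(1) \<delta>(1)] .
  have TZ: "T = (T - Z) \<union> Z" using T by auto
  have Tm: "T \<in> lmeasurable" by (subst TZ) (intro fmeasurable.Un T negligible_imp_measurable Z)
  have "measure lebesgue T = measure lebesgue (T - Z)"
    using measure_Un_null_set[of "T - Z" lebesgue Z] T(3) Zs(2) TZ by (auto simp: fmeasurableD)
  also have "\<dots> < \<delta>"
    using T(4) \<delta>(1) fmeasurableD2[OF T(3)] by (simp add: measure_def enn2real_less_iff less_top)
  finally have mT: "measure lebesgue T < \<delta>" .
  have "\<exists>d>0. (x \<in> {a..b} - Z \<longrightarrow>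
         (\<forall>y\<in>{a..b}. norm (y-x) < d \<longrightarrow> norm (f y - f x - (y-x) *\<^sub>R g
           x) \<le> e1 * norm (y-x))) \<and>
       (x \<in> Z \<longrightarrow> ball x d \<subseteq> T)" for x
  proof (cases "x \<in> Z")
    case True
    then show ?thesis using T openE by blast
  next
    case False
    show ?thesis
    proof (cases "x \<in> {a..b}")
      case True
      with False have "(f has_vector_derivative g x) (at x within {a..b})"
        using deriv has_real_derivative_iff_has_vector_derivative by blast
      then show ?thesis using e1(1) False
        unfolding has_vector_derivative_def has_derivative_within_alt by blast
    \<comment> \<open>The tags of a division of \<open>{a..b}\<close> lie in \<open>{a..b}\<close>,
      so any radius will do elsewhere.\<close>
    qed (use False in \<open>auto intro: exI[of _ 1]\<close>)
  qed
  then obtain d where d: "\<And>x. 0 < d x"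
     "\<And>x y. \<lbrakk>x \<in> {a..b} - Z; y \<in> {a..b}; norm (y-x) < d x\<rbrakk>
                        \<Longrightarrow> norm (f y - f x - (y-x) *\<^sub>R g x) \<le> e1 * norm (y-x)"
     "\<And>x. x \<in> Z \<Longrightarrow> ball x (d x) \<subseteq> T"
    by metis
  show "\<exists>\<gamma>. gauge \<gamma> \<and> (\<forall>\<D>. \<D> tagged_division_of (cbox a b)
    \<and> \<gamma> fine \<D> \<longrightarrow>
          norm ((\<Sum>(x, k)\<in>\<D>. measure lborel k *\<^sub>R g x) - (f b - f a)) < e)"
  proof (intro exI conjI allI impI)
    show "gauge (\<lambda>x. ball x (d x))" using d(1) gauge_ball_dependent by blast
    fix p assume p: "p tagged_division_of cbox a b \<and> (\<lambda>x. ball x (d x)) fine p"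
    then have ptag: "p tagged_division_of cbox a b" and finep: "(\<lambda>x. ball x (d x)) fine p" by auto
    note pD = tagged_division_ofD[OF ptag]
    define F where "F = (\<lambda>(x,K). measure lborel K *\<^sub>R g x - (f (Sup K) - f (Inf K)))"
    define pZ where "pZ = {q\<in>p. fst q \<in> Z}"
    have KI: "\<exists>u v. K = {u..v} \<and> u \<le> v \<and> x \<in> {u..v} \<and> u \<in> {a..b}
      \<and> v \<in> {a..b}" if xK: "(x,K) \<in> p" for x K
    proof -
      obtain u v where "K = {u..v}" using pD(4)[OF xK] by auto
      moreover have "x \<in> K" "K \<subseteq> {a..b}" using pD(2,3)[OF xK] by auto
      ultimately show ?thesis by auto
    qed
    have ba: "b - a = (\<Sum>(x,K)\<in>p. Sup K - Inf K)" "f b - f a = (\<Sum>(x,K)\<in>p. f(Sup K) -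
      f(Inf K))"
      using additive_tagged_division_1[where f= "\<lambda>x. x"] additive_tagged_division_1[where f= f]
            \<open>a \<le> b\<close> ptag by auto
    have eq: "(\<Sum>(x, k)\<in>p. measure lborel k *\<^sub>R g x) - (f b - f a) = sum F p"
      unfolding F_def ba by (simp add: sum_subtractf split_def)
    have split: "sum F p = sum F (p - pZ) + sum F pZ"
      by (rule sum.subset_diff) (auto simp: pZ_def pD)
    have "norm (sum F (p - pZ)) \<le> (\<Sum>(x,K)\<in>p - pZ. e1 * (Sup K - Inf K))"
    proof (rule sum_norm_le, clarify)
      fix x K assume xK: "(x,K) \<in> p" "(x,K) \<notin> pZ"
      then obtain u v where k: "K = {u..v}" "u \<le> v" "x \<in> {u..v}" "u \<in> {a..b}" "v \<in> {a..b}"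
        using KI by blast
      have ball: "K \<subseteq> ball x (d x)" using finep xK by (auto simp: fine_def)
      then have "u \<in> ball x (d x)" "v \<in> ball x (d x)" using subsetD[OF ball] k by auto
      then have uv: "norm (u - x) < d x" "norm (v - x) < d x"
        by (auto simp: dist_norm norm_minus_commute)
      have x: "x \<in> {a..b} - Z" using xK k by (auto simp: pZ_def)
      \<comment> \<open>Straddle estimate: measured from the tag, the two linear errors combine into
        \<open>F\<close>, and since \<open>x\<close> lies between \<open>u\<close> and
        \<open>v\<close> the two distances add up to the length of \<open>K\<close>.\<close>
      have "norm (F (x,K)) = norm ((f u - f x - (u - x) *\<^sub>R g x) - (f v - f x - (v - x) *\<^sub>R g x))"
        using k by (simp add: F_def algebra_simps)
      also have "\<dots> \<le> e1 * norm (u - x) + e1 * norm (v - x)"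
        by (intro order_trans[OF norm_triangle_ineq4] add_mono d(2) x k uv)
      also have "\<dots> = e1 * (Sup K - Inf K)" using k by (simp add: algebra_simps)
      finally show "norm (F (x,K)) \<le> e1 * (Sup K - Inf K)" .
    qed
    also have "\<dots> \<le> (\<Sum>(x,K)\<in>p. e1 * (Sup K - Inf K))"
      using pD(1) e1(1) KI by (intro sum_mono2) (auto; fastforce)+
    also have "\<dots> = e1 * (b - a)" unfolding ba by (simp add: sum_distrib_left split_def)
    also have "\<dots> < e/2" by (rule e1)
    finally have 1: "norm (sum F (p - pZ)) < e/2" .
    have pZt: "pZ tagged_partial_division_of cbox a b"
      by (rule tagged_partial_division_subset[of p]) (use ptag in \<open>auto simp: pZ_def
        tagged_division_of_def\<close>)
    define D where "D = snd ` pZ"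
    have D: "D division_of \<Union>D"
      unfolding D_def by (rule partial_division_of_tagged_division[OF pZt])
    have DT: "\<Union>D \<subseteq> T"
    proof (rule Union_least)
      fix K assume "K \<in> D"
      then obtain x where "(x,K) \<in> p" "x \<in> Z" by (auto simp: D_def pZ_def)
      then show "K \<subseteq> T" using fineD[OF finep] d(3) by blast
    qed
    have "(\<Sum>K\<in>D. Sup K - Inf K) = sum (measure lebesgue) D"
    proof (rule sum.cong)
      fix K assume "K \<in> D"
      then obtain x where "(x,K) \<in> p" by (auto simp: D_def pZ_def)
      with KI obtain u v where "K = {u..v}" "u \<le> v" by blast
      then show "Sup K - Inf K = measure lebesgue K" by simp
    qed simp
    also have "\<dots> = measure lebesgue (\<Union>D)" using content_division[OF D] by simp
    also have "\<dots> \<le> measure lebesgue T"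
      by (rule measure_mono_fmeasurable[OF DT _ Tm]) (rule fmeasurableD[OF lmeasurable_division[OF D]])
    finally have "(\<Sum>K\<in>D. Sup K - Inf K) < \<delta>" using mT by simp
    moreover have "\<Union>D \<subseteq> {a..b}"
    proof (rule Union_least)
      fix K assume "K \<in> D"
      then obtain x where "(x,K) \<in> p" by (auto simp: D_def pZ_def)
      with pD(3) show "K \<subseteq> {a..b}" by simp
    qed
    ultimately have "(\<Sum>K\<in>D. dist (f (Inf K)) (f (Sup K))) < e/2" using \<delta>(2) D by blast
    moreover have "(\<Sum>(x,K)\<in>pZ. dist (f (Inf K)) (f (Sup K))) = (\<Sum>K\<in>D. dist (f (Inf
      K)) (f (Sup K)))"
    proof -
      \<comment> \<open>Different tags can share an interval only if it is degenerate, where the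
        increment of \<open>f\<close> is zero; hence the sum over tagged pairs equals the sum over
        intervals. The rule used for this also asks for the value at \<open>{}\<close>, where
        \<open>Inf\<close> and \<open>Sup\<close> are unspecified, hence the case
        distinction.\<close>
      define h where "h K = (if K = {} then 0 else dist (f (Inf K)) (f (Sup K)))" for K
      have ne: "K \<noteq> {}" if "(x,K) \<in> p" for x K using pD(2)[OF that] by blast
      have "(\<Sum>(x,K)\<in>pZ. dist (f (Inf K)) (f (Sup K))) = (\<Sum>(x,K)\<in>pZ. h K)"
        using ne by (intro sum.cong) (auto simp: h_def pZ_def)
      also have "\<dots> = sum h D"
        unfolding D_def
        by (rule sum.over_tagged_division_lemma[OF tagged_partial_division_of_Union_self[OF pZt]])
           (auto simp: h_def box_eq_empty not_less le_less)
      also have "\<dots> = (\<Sum>K\<in>D. dist (f (Inf K)) (f (Sup K)))"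
        using ne by (intro sum.cong) (auto simp: h_def D_def pZ_def)
      finally show ?thesis .
    qed
    moreover have "norm (sum F pZ) \<le> (\<Sum>(x,K)\<in>pZ. dist (f (Inf K)) (f (Sup K)))"
      by (rule sum_norm_le) (auto simp: F_def pZ_def g0 dist_real_def)
    ultimately have "norm (sum F pZ) < e/2" by simp
    with 1 show "norm ((\<Sum>(x, k)\<in>p. measure lborel k *\<^sub>R g x) - (f b - f a)) < e"
      unfolding eq split using norm_triangle_ineq[of "sum F (p - pZ)" "sum F pZ"] by linarith
  qed
qed

text \<open>Resetting the integrand to \<open>0\<close> on the negligible set where the derivative
  fails does not change its gauge integral, and the assumed integrability identifies the gauge
  integral of \<open>g\<close> with the Lebesgue one.\<close>

lemma abs_continuous_ftc:
  fixes f g :: "real \<Rightarrow> real"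
  assumes "a \<le> b" and ac: "abs_continuous dist {a..b} f"
    and deriv: "AE t in lebesgue_on {a..b}. (f has_real_derivative g t) (at t within {a..b})"
    and int: "integrable (lebesgue_on {a..b}) g"
  shows "f b - f a = (\<integral>t. g t \<partial>lebesgue_on {a..b})"
proof -
  define Z where "Z = {t\<in>{a..b}. \<not> (f has_real_derivative g t) (at t within {a..b})}"
  have "AE t in lebesgue. t \<in> {a..b} \<longrightarrow> (f has_real_derivative g t) (at t within {a..b})"
    using deriv by (subst (asm) AE_restrict_space_iff) auto
  then have Z: "negligible Z"
    by (simp add: completion.AE_iff_null_sets Z_def negligible_iff_null_sets)
  have "((\<lambda>t. if t \<in> Z then 0 else g t) has_integral f b - f a) {a..b}"
    by (rule abs_continuous_has_integral[OF \<open>a \<le> b\<close> ac Z]) (auto simp: Z_def)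
  then have "(g has_integral f b - f a) {a..b}"
    by (rule has_integral_spike[OF Z, rotated]) auto
  moreover have "(g has_integral (\<integral>t. g t \<partial>lebesgue_on {a..b})) {a..b}"
    by (rule has_integral_integral_lebesgue_on[OF int]) auto
  ultimately show ?thesis by (rule has_integral_unique)
qed

section \<open>Calculus in \<open>L\<^sup>2\<close>\<close>

lemma square_integrableD:
  assumes "square_integrable M f"
  shows square_integrable_measurable: "f \<in> borel_measurable M"
    and square_integrable_norm: "integrable M (\<lambda>x. (norm (f x))\<^sup>2)"
  using assms by (auto simp: square_integrable_def)

lemma square_integrable_inner:
  assumes "square_integrable M f" "square_integrable M g"
  shows "integrable M (\<lambda>x. f x \<bullet> g x)"
proof (rule Bochner_Integration.integrable_bound)
  show "integrable M (\<lambda>x. (norm (f x))\<^sup>2 + (norm (g x))\<^sup>2)"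
    using assms by (simp add: square_integrable_norm)
  show "(\<lambda>x. f x \<bullet> g x) \<in> borel_measurable M"
    using assms by (intro borel_measurable_inner square_integrable_measurable)
  show "AE x in M. norm (f x \<bullet> g x) \<le> norm ((norm (f x))\<^sup>2 + (norm (g x))\<^sup>2)"
  proof (rule AE_I2)
    fix x
    have "norm (f x \<bullet> g x) \<le> norm (f x) * norm (g x)" using Cauchy_Schwarz_ineq2 by simp
    also have "\<dots> \<le> (norm (f x))\<^sup>2 + (norm (g x))\<^sup>2"
      using sum_squares_bound[of "norm (f x)" "norm (g x)"] mult_nonneg_nonneg[OF norm_ge_zero
        norm_ge_zero, of "f x" "g x"] by linarith
    finally show "norm (f x \<bullet> g x) \<le> norm ((norm (f x))\<^sup>2 + (norm (g x))\<^sup>2)" by simp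
  qed
qed

text \<open>Scaling, symmetrization and trace are all of this kind, so the symmetric gradient and
  the divergence inherit square integrability from the weak gradient.\<close>

lemma square_integrable_bounded_linear:
  assumes A: "bounded_linear A" and f: "square_integrable M f"
  shows "square_integrable M (\<lambda>x. A (f x))"
proof -
  obtain K where K: "\<And>x. norm (A x) \<le> norm x * K" using bounded_linear.bounded[OF A] by blast
  have [measurable]: "A \<in> borel_measurable borel"
    by (rule borel_measurable_continuous_onI) (simp add: A linear_continuous_on)
  have [measurable]: "f \<in> borel_measurable M" by (rule square_integrable_measurable[OF f])
  have m: "(\<lambda>x. A (f x)) \<in> borel_measurable M" by measurable
  have "integrable M (\<lambda>x. (norm (A (f x)))\<^sup>2)"
  proof (rule Bochner_Integration.integrable_bound)
    show "integrable M (\<lambda>x. K\<^sup>2 * (norm (f x))\<^sup>2)"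
      using f by (intro integrable_mult_right square_integrable_norm)
    show "AE x in M. norm ((norm (A (f x)))\<^sup>2) \<le> norm (K\<^sup>2 * (norm (f x))\<^sup>2)"
      using power_mono[OF K norm_ge_zero, of _ 2] by (simp add: power_mult_distrib mult.commute)
  qed (use m in simp)
  with m show ?thesis by (simp add: square_integrable_def)
qed

lemma square_integrable_scaleR:
  "square_integrable M f \<Longrightarrow> square_integrable M (\<lambda>x. c *\<^sub>R f x)"
  by (rule square_integrable_bounded_linear[OF bounded_linear_scaleR_right])

lemma square_integrable_add:
  assumes "square_integrable M f" "square_integrable M g"
  shows "square_integrable M (\<lambda>x. f x + g x)"
proof -
  have m: "(\<lambda>x. f x + g x) \<in> borel_measurable M"
    using assms by (intro borel_measurable_add square_integrable_measurable)
  have "(\<lambda>x. (norm (f x + g x))\<^sup>2) = (\<lambda>x. f x \<bullet> f x + 2 * (f x \<bullet>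
    g x) + g x \<bullet> g x)"
    by (simp add: power2_norm_eq_inner algebra_simps inner_commute)
  moreover have "integrable M \<dots>"
    using assms by (intro Bochner_Integration.integrable_add integrable_mult_right square_integrable_inner)
  ultimately show ?thesis using m by (simp add: square_integrable_def)
qed

lemma square_integrable_diff:
  assumes "square_integrable M f" "square_integrable M g"
  shows "square_integrable M (\<lambda>x. f x - g x)"
  using square_integrable_add[OF assms(1) square_integrable_scaleR[OF assms(2), of "-1"]] by simp

lemma L2sq_nonneg: "0 \<le> L2sq M f"
  by (simp add: L2sq_def)

lemma L2sq_inner: "L2sq M f = (\<integral>x. f x \<bullet> f x \<partial>M)"
  by (simp add: L2sq_def power2_norm_eq_inner)

lemma L2sq_scaleR: "L2sq M (\<lambda>x. c *\<^sub>R f x) = c\<^sup>2 * L2sq M f"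
  by (simp add: L2sq_def power_mult_distrib)

lemma L2sq_add:
  assumes "square_integrable M f" "square_integrable M g"
  shows "L2sq M (\<lambda>x. f x + g x) = L2sq M f + 2 * (\<integral>x. f x \<bullet> g x \<partial>M)
    + L2sq M g"
proof -
  have "(\<lambda>x. (f x + g x) \<bullet> (f x + g x)) = (\<lambda>x. f x \<bullet> f x + 2 * (f x
    \<bullet> g x) + g x \<bullet> g x)"
    by (simp add: algebra_simps inner_commute)
  then show ?thesis
    unfolding L2sq_inner using assms
    by (simp add: square_integrable_inner)
qed

lemma L2sq_diff:
  assumes "square_integrable M f" "square_integrable M g"
  shows "L2sq M (\<lambda>x. f x - g x) = L2sq M f - 2 * (\<integral>x. f x \<bullet> g x \<partial>M)
    + L2sq M g"
  using L2sq_add[OF assms(1) square_integrable_scaleR[OF assms(2), of "-1"]] L2sq_scaleR[of M "-1" g]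
  by simp

text \<open>The parallelogram law with the term of the difference dropped.\<close>

lemma L2sq_add_le:
  assumes "square_integrable M f" "square_integrable M g"
  shows "L2sq M (\<lambda>x. f x + g x) \<le> 2 * L2sq M f + 2 * L2sq M g"
  using L2sq_add[OF assms] L2sq_diff[OF assms] L2sq_nonneg[of M "\<lambda>x. f x - g x"] by linarith

lemma L2_Cauchy_Schwarz:
  assumes "square_integrable M f" "square_integrable M g"
  shows "\<bar>\<integral>x. f x \<bullet> g x \<partial>M\<bar> \<le> sqrt (L2sq M f) * sqrt (L2sq M g)"
proof -
  define I where "I = (\<integral>x. f x \<bullet> g x \<partial>M)"
  have *: "0 \<le> L2sq M f - 2 * c * I + c\<^sup>2 * L2sq M g" for c
    using L2sq_nonneg[of M "\<lambda>x. f x - c *\<^sub>R g x"]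
    by (simp add: L2sq_diff[OF assms(1) square_integrable_scaleR[OF assms(2)]] L2sq_scaleR I_def mult.assoc)
  have "I\<^sup>2 \<le> L2sq M f * L2sq M g"
  proof (cases "L2sq M g = 0")
    case True
    have "I = 0"
    proof (rule ccontr)
      assume "I \<noteq> 0"
      \<comment> \<open>When \<open>L2sq M g = 0\<close> the nonnegative expression is affine in
        \<open>c\<close>; this \<open>c\<close> makes it equal to \<open>-1\<close>.\<close>
      with *[of "(L2sq M f + 1) / (2 * I)"] True show False by simp
    qed
    then show ?thesis by (simp add: True)
  next
    case False
    then have "L2sq M g > 0" using L2sq_nonneg[of M g] by linarith
    \<comment> \<open>The \<open>c\<close> that minimizes the quadratic.\<close>
    with *[of "I / L2sq M g"] show ?thesis
      by (simp add: power2_eq_square field_simps)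
  qed
  then have "\<bar>I\<bar> \<le> sqrt (L2sq M f * L2sq M g)"
    using real_le_rsqrt by (metis power2_abs)
  then show ?thesis by (simp add: I_def real_sqrt_mult)
qed

text \<open>\<open>L2_converges\<close> for an arbitrary filter, because both spatial approximations
  and limits in time occur. Square integrability is asked for only eventually, since an evolution is
  controlled only for times in its interval.\<close>

definition L2_tendsto :: "'a measure \<Rightarrow> ('c \<Rightarrow> 'a \<Rightarrow>
  'b::euclidean_space) \<Rightarrow> ('a \<Rightarrow> 'b) \<Rightarrow> 'c filter \<Rightarrow> bool" where
  "L2_tendsto M fs f F \<longleftrightarrow> (\<forall>\<^sub>F k in F. square_integrable M (fs k))
    \<and> square_integrable M f \<and>
     ((\<lambda>k. L2sq M (\<lambda>x. fs k x - f x)) \<longlongrightarrow> 0) F"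

lemma L2_converges_imp_tendsto: "L2_converges M fs f \<Longrightarrow> L2_tendsto M fs f sequentially"
  by (simp add: L2_converges_def L2_tendsto_def)

lemma L2_tendsto_const: "square_integrable M f \<Longrightarrow> L2_tendsto M (\<lambda>_. f) f F"
  by (simp add: L2_tendsto_def L2sq_def)

lemma L2_tendsto_add:
  assumes "L2_tendsto M fs f F" "L2_tendsto M gs g F"
  shows "L2_tendsto M (\<lambda>k x. fs k x + gs k x) (\<lambda>x. f x + g x) F"
proof -
  have ev: "\<forall>\<^sub>F k in F. square_integrable M (fs k) \<and> square_integrable M (gs k)"
    using assms by (simp add: L2_tendsto_def eventually_conj_iff)
  have si: "square_integrable M f" "square_integrable M g" using assms by (auto simp: L2_tendsto_def)
  have "((\<lambda>k. 2 * L2sq M (\<lambda>x. fs k x - f x) + 2 * L2sq M (\<lambda>x. gs k x - g x))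
    \<longlongrightarrow> 2 * 0 + 2 * 0) F"
    using assms by (intro tendsto_intros) (auto simp: L2_tendsto_def)
  then have lim: "((\<lambda>k. 2 * L2sq M (\<lambda>x. fs k x - f x) + 2 * L2sq M (\<lambda>x. gs k x
    - g x)) \<longlongrightarrow> 0) F"
    by simp
  have "((\<lambda>k. L2sq M (\<lambda>x. (fs k x + gs k x) - (f x + g x))) \<longlongrightarrow> 0) F"
  proof (rule Lim_null_comparison[OF _ lim], unfold real_norm_def abs_of_nonneg[OF L2sq_nonneg])
    show "\<forall>\<^sub>F k in F. L2sq M (\<lambda>x. (fs k x + gs k x) - (f x + g x))
        \<le> 2 * L2sq M (\<lambda>x. fs k x - f x) + 2 * L2sq M (\<lambda>x. gs k x - g x)"
      using ev
    proof eventually_elim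
      case (elim k)
      have "(\<lambda>x. (fs k x + gs k x) - (f x + g x)) = (\<lambda>x. (fs k x - f x) + (gs k x - g
        x))" by auto
      with elim si show ?case by (auto intro!: L2sq_add_le square_integrable_diff)
    qed
  qed
  with ev si show ?thesis
    unfolding L2_tendsto_def by (auto elim!: eventually_mono intro: square_integrable_add)
qed

lemma L2_tendsto_bounded_linear:
  assumes A: "bounded_linear A" and f: "L2_tendsto M fs f F"
  shows "L2_tendsto M (\<lambda>k x. A (fs k x)) (\<lambda>x. A (f x)) F"
proof -
  obtain K where K: "\<And>x. norm (A x) \<le> norm x * K" using bounded_linear.bounded[OF A] by blast
  have ev: "\<forall>\<^sub>F k in F. square_integrable M (fs k)" and si: "square_integrable M f"
    using f by (auto simp: L2_tendsto_def)
  have "((\<lambda>k. K\<^sup>2 * L2sq M (\<lambda>x. fs k x - f x)) \<longlongrightarrow> K\<^sup>2 * 0) F"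
    using f by (intro tendsto_intros) (auto simp: L2_tendsto_def)
  then have lim: "((\<lambda>k. K\<^sup>2 * L2sq M (\<lambda>x. fs k x - f x)) \<longlongrightarrow> 0)
    F" by simp
  have "((\<lambda>k. L2sq M (\<lambda>x. A (fs k x) - A (f x))) \<longlongrightarrow> 0) F"
  proof (rule Lim_null_comparison[OF _ lim], unfold real_norm_def abs_of_nonneg[OF L2sq_nonneg])
    show "\<forall>\<^sub>F k in F. L2sq M (\<lambda>x. A (fs k x) - A (f x)) \<le> K\<^sup>2 * L2sq M
      (\<lambda>x. fs k x - f x)"
      using ev
    proof eventually_elim
      case (elim k)
      have d: "square_integrable M (\<lambda>x. fs k x - f x)" using elim si by (rule square_integrable_diff)
      have "(\<integral>x. (norm (A (fs k x - f x)))\<^sup>2 \<partial>M) \<le> (\<integral>x.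
        K\<^sup>2 * (norm (fs k x - f x))\<^sup>2 \<partial>M)"
        using square_integrable_norm[OF square_integrable_bounded_linear[OF A d]] square_integrable_norm[OF d]
          power_mono[OF K norm_ge_zero, of _ 2]
        by (intro integral_mono) (auto simp: power_mult_distrib mult.commute)
      then show ?case
        by (simp add: L2sq_def linear_diff[OF bounded_linear.linear[OF A]])
    qed
  qed
  with ev si show ?thesis
    unfolding L2_tendsto_def by (auto elim!: eventually_mono intro: square_integrable_bounded_linear[OF A])
qed

lemma L2_tendsto_scaleR:
  "L2_tendsto M fs f F \<Longrightarrow> L2_tendsto M (\<lambda>k x. c *\<^sub>R fs k x) (\<lambda>x. c
    *\<^sub>R f x) F"
  by (rule L2_tendsto_bounded_linear[OF bounded_linear_scaleR_right])

lemma L2_tendsto_diff: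
  assumes "L2_tendsto M fs f F" "L2_tendsto M gs g F"
  shows "L2_tendsto M (\<lambda>k x. fs k x - gs k x) (\<lambda>x. f x - g x) F"
  using L2_tendsto_add[OF assms(1) L2_tendsto_scaleR[OF assms(2), of "-1"]] by simp

lemma L2_tendsto_inner:
  assumes f: "L2_tendsto M fs f F" and g: "L2_tendsto M gs g F"
  shows "((\<lambda>k. \<integral>x. fs k x \<bullet> gs k x \<partial>M) \<longlongrightarrow>
    (\<integral>x. f x \<bullet> g x \<partial>M)) F"
proof -
  have ev: "\<forall>\<^sub>F k in F. square_integrable M (fs k) \<and> square_integrable M (gs k)"
    using assms by (simp add: L2_tendsto_def eventually_conj_iff)
  have si: "square_integrable M f" "square_integrable M g" using assms by (auto simp: L2_tendsto_def)
  define a b where "a k = sqrt (L2sq M (\<lambda>x. fs k x - f x))" and "b k = sqrt (L2sq M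
    (\<lambda>x. gs k x - g x))" for k
  have "(a \<longlongrightarrow> sqrt 0) F" "(b \<longlongrightarrow> sqrt 0) F"
    unfolding a_def b_def using assms by (auto intro!: tendsto_real_sqrt simp: L2_tendsto_def simp del:
      real_sqrt_zero)
  then have "((\<lambda>k. a k * b k + a k * sqrt (L2sq M g) + sqrt (L2sq M f) * b k) \<longlongrightarrow>
     sqrt 0 * sqrt 0 + sqrt 0 * sqrt (L2sq M g) + sqrt (L2sq M f) * sqrt 0) F"
    by (intro tendsto_intros)
  then have lim: "((\<lambda>k. a k * b k + a k * sqrt (L2sq M g) + sqrt (L2sq M f) * b k)
    \<longlongrightarrow> 0) F" by simp
  have "((\<lambda>k. (\<integral>x. fs k x \<bullet> gs k x \<partial>M) - (\<integral>x. f x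
    \<bullet> g x \<partial>M)) \<longlongrightarrow> 0) F"
  proof (rule Lim_null_comparison[OF _ lim])
    show "\<forall>\<^sub>F k in F. norm ((\<integral>x. fs k x \<bullet> gs k x \<partial>M) -
      (\<integral>x. f x \<bullet> g x \<partial>M))
        \<le> a k * b k + a k * sqrt (L2sq M g) + sqrt (L2sq M f) * b k"
      using ev
    proof eventually_elim
      case (elim k)
      have d: "square_integrable M (\<lambda>x. fs k x - f x)" "square_integrable M (\<lambda>x. gs k x
        - g x)"
        using elim si by (auto intro: square_integrable_diff)
      have "(\<integral>x. fs k x \<bullet> gs k x \<partial>M) - (\<integral>x. f x \<bullet> g x
        \<partial>M) = (\<integral>x. fs k x \<bullet> gs k x - f x \<bullet> g x \<partial>M)"
        using elim si by (simp add: square_integrable_inner)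
      \<comment> \<open>This splitting leaves only errors and the limits themselves as factors, so
        no bound on the norms of \<open>fs k\<close> and \<open>gs k\<close> has to be
        established.\<close>
      also have "\<dots> = (\<integral>x. (fs k x - f x) \<bullet> (gs k x - g x) + (fs k x - f x)
        \<bullet> g x + f x \<bullet> (gs k x - g x) \<partial>M)"
        by (intro Bochner_Integration.integral_cong) (auto simp: algebra_simps)
      also have "\<dots> = (\<integral>x. (fs k x - f x) \<bullet> (gs k x - g x) \<partial>M) +
        (\<integral>x. (fs k x - f x) \<bullet> g x \<partial>M)
           + (\<integral>x. f x \<bullet> (gs k x - g x) \<partial>M)"
        using d si by (simp add: square_integrable_inner)
      finally show ?case
        using L2_Cauchy_Schwarz[OF d] L2_Cauchy_Schwarz[OF d(1) si(2)] L2_Cauchy_Schwarz[OF si(1) d(2)]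
        unfolding a_def b_def real_norm_def by linarith
    qed
  qed
  then show ?thesis by (rule LIM_zero_cancel)
qed

lemma L2_tendsto_L2sq: "L2_tendsto M fs f F \<Longrightarrow> ((\<lambda>k. L2sq M (fs k))
  \<longlongrightarrow> L2sq M f) F"
  unfolding L2sq_inner by (rule L2_tendsto_inner)

lemma L2_dist_tendsto_0_iff: "((\<lambda>k. L2_dist M (fs k) f) \<longlongrightarrow> 0) F
  \<longleftrightarrow> ((\<lambda>k. L2sq M (\<lambda>x. fs k x - f x)) \<longlongrightarrow> 0) F"
proof
  assume "((\<lambda>k. L2_dist M (fs k) f) \<longlongrightarrow> 0) F"
  then have "((\<lambda>k. (L2_dist M (fs k) f)\<^sup>2) \<longlongrightarrow> 0\<^sup>2) F" by (rule
    tendsto_power)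
  then show "((\<lambda>k. L2sq M (\<lambda>x. fs k x - f x)) \<longlongrightarrow> 0) F" by (simp add:
    L2_dist_def L2sq_nonneg)
next
  assume "((\<lambda>k. L2sq M (\<lambda>x. fs k x - f x)) \<longlongrightarrow> 0) F"
  then have "((\<lambda>k. sqrt (L2sq M (\<lambda>x. fs k x - f x))) \<longlongrightarrow> sqrt 0) F"
    by (rule tendsto_real_sqrt)
  then show "((\<lambda>k. L2_dist M (fs k) f) \<longlongrightarrow> 0) F" by (simp add: L2_dist_def)
qed

lemma has_L2_deriv_tendsto:
  assumes si: "\<And>s. s \<in> S \<Longrightarrow> square_integrable M (f s)" and "t \<in> S"
    and d: "has_L2_deriv M f g (at t within S) t"
  shows "L2_tendsto M (\<lambda>s x. (1 / (s - t)) *\<^sub>R (f s x - f t x)) g (at t within S)"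
proof -
  have "\<forall>\<^sub>F s in at t within S. s \<in> S"
    by (simp add: eventually_at_filter)
  then have "\<forall>\<^sub>F s in at t within S. square_integrable M (\<lambda>x. (1 / (s - t))
    *\<^sub>R (f s x - f t x))"
    by eventually_elim (intro square_integrable_scaleR square_integrable_diff si \<open>t \<in> S\<close>)
  with d show ?thesis by (simp add: L2_tendsto_def has_L2_deriv_def L2_dist_tendsto_0_iff)
qed

lemma L2_evolution_tendsto:
  assumes "L2_evolution M a b f" "t \<in> {a..b}"
  shows "L2_tendsto M f (f t) (at t within {a..b})"
proof -
  have "\<forall>\<^sub>F s in at t within {a..b}. s \<in> {a..b}" by (simp add: eventually_at_filter)
  then have "\<forall>\<^sub>F s in at t within {a..b}. square_integrable M (f s)"
    by eventually_elim (use assms in \<open>simp add: L2_evolution_def\<close>)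
  with assms show ?thesis by (simp add: L2_tendsto_def L2_evolution_def L2_dist_tendsto_0_iff)
qed

text \<open>From \<open>|p|^2 - |q|^2 = (p - q) \<bullet> (p + q)\<close>: the quotient of the
  squared norms is the pairing of the difference quotient, which tends to \<open>A g\<close>, with a
  sum that tends to \<open>2 A (f t)\<close>. Carrying \<open>A\<close> along gives the derivatives
  for the symmetric gradient and for the divergence from a single hypothesis on the weak
  gradient.\<close>

lemma L2sq_bounded_linear_deriv:
  assumes A: "bounded_linear A" and ev: "L2_evolution M a b f" and t: "t \<in> {a..b}"
    and d: "has_L2_deriv M f g (at t within {a..b}) t"
  shows "((\<lambda>s. L2sq M (\<lambda>x. A (f s x))) has_real_derivative 2 * (\<integral>x. A (f t x)
    \<bullet> A (g x) \<partial>M)) (at t within {a..b})"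
proof -
  have si: "square_integrable M (\<lambda>x. A (f s x))" if "s \<in> {a..b}" for s
    using ev that by (auto simp: L2_evolution_def intro: square_integrable_bounded_linear[OF A])
  define D where "D s x = A ((1 / (s - t)) *\<^sub>R (f s x - f t x))" for s x
  have D: "L2_tendsto M D (\<lambda>x. A (g x)) (at t within {a..b})"
    unfolding D_def using ev t d
    by (intro L2_tendsto_bounded_linear[OF A] has_L2_deriv_tendsto) (auto simp: L2_evolution_def)
  have S: "L2_tendsto M (\<lambda>s x. A (f s x) + A (f t x)) (\<lambda>x. A (f t x) + A (f t x)) (at t
    within {a..b})"
    using ev t si[OF t]
    by (intro L2_tendsto_add L2_tendsto_const L2_tendsto_bounded_linear[OF A] L2_evolution_tendsto) auto
  have lim: "((\<lambda>s. \<integral>x. D s x \<bullet> (A (f s x) + A (f t x)) \<partial>M)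
    \<longlongrightarrow> (\<integral>x. A (g x) \<bullet> (A (f t x) + A (f t x)) \<partial>M)) (at t
      within {a..b})"
    by (rule L2_tendsto_inner[OF D S])
  have eq: "(\<integral>x. A (g x) \<bullet> (A (f t x) + A (f t x)) \<partial>M) = 2 * (\<integral>x.
    A (f t x) \<bullet> A (g x) \<partial>M)"
    by (simp add: inner_commute flip: scaleR_2)
  have "\<forall>\<^sub>F s in at t within {a..b}. s \<in> {a..b}" by (simp add: eventually_at_filter)
  then have ev': "\<forall>\<^sub>F s in at t within {a..b}. (\<integral>x. D s x \<bullet> (A (f s x)
    + A (f t x)) \<partial>M)
      = (L2sq M (\<lambda>x. A (f s x)) - L2sq M (\<lambda>x. A (f t x))) / (s - t)"
  proof eventually_elim
    case (elim s)
    have "D s x \<bullet> (A (f s x) + A (f t x)) = (A (f s x) \<bullet> A (f s x) - A (f t x)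
      \<bullet> A (f t x)) / (s - t)" for x
      by (simp add: D_def linear_cmul[OF bounded_linear.linear[OF A]] linear_diff[OF
        bounded_linear.linear[OF A]]
           inner_simps inner_commute)
    then show ?case using si[OF elim] si[OF t]
      by (simp add: L2sq_inner square_integrable_inner)
  qed
  show ?thesis
    using Lim_transform_eventually[OF lim ev'] unfolding has_field_derivative_iff eq .
qed

lemma L2sq_deriv:
  assumes "L2_evolution M a b f" "t \<in> {a..b}" "has_L2_deriv M f g (at t within {a..b}) t"
  shows "((\<lambda>s. L2sq M (f s)) has_real_derivative 2 * (\<integral>x. f t x \<bullet> g x
    \<partial>M)) (at t within {a..b})"
  using L2sq_bounded_linear_deriv[OF bounded_linear_ident assms] .

section \<open>Complete measures and the surface measure\<close>

lemma complete_measure_restrict_space: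
  assumes "complete_measure M" "S \<in> sets M"
  shows "complete_measure (restrict_space M S)"
proof
  fix A B assume "A \<subseteq> B" "B \<in> null_sets (restrict_space M S)"
  moreover have "S \<inter> space M = S" using sets.sets_into_space[OF assms(2)] by blast
  ultimately show "A \<in> sets (restrict_space M S)"
    using complete_measure.complete[OF assms(1), of A B] assms(2)
    by (auto simp: null_sets_restrict_space sets_restrict_space_iff)
qed

text \<open>The model equates functions almost everywhere, often without stating that both are
  measurable; completeness supplies this.\<close>

lemma (in complete_measure) borel_measurable_AE_eq:
  assumes f: "f \<in> borel_measurable M" and eq: "AE x in M. f x = g x"
  shows "g \<in> borel_measurable M"
proof (rule measurableI)
  fix A :: "'b set" assume A: "A \<in> sets borel"
  define N where "N = {x\<in>space M. f x \<noteq> g x}"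
  have N: "N \<in> null_sets M" using eq by (simp add: AE_iff_null_sets N_def)
  have fA: "f -` A \<inter> space M \<in> sets M" by (rule measurable_sets[OF f A])
  have gN: "g -` A \<inter> N \<in> sets M" by (rule complete[OF _ N]) auto
  have "g -` A \<inter> space M = ((f -` A \<inter> space M) - N) \<union> (g -` A \<inter> N)"
    by (auto simp: N_def)
  also have "\<dots> \<in> sets M" using fA gN N by auto
  finally show "g -` A \<inter> space M \<in> sets M" .
qed auto

lemma (in complete_measure) integral_AE_eq:
  fixes f g :: "'a \<Rightarrow> 'b::{banach, second_countable_topology}"
  assumes eq: "AE x in M. f x = g x"
  shows "integral\<^sup>L M f = integral\<^sup>L M g"
proof (cases "f \<in> borel_measurable M")
  case True
  then show ?thesis using integral_cong_AE[OF True borel_measurable_AE_eq[OF True eq] eq] by simp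
next
  case False
  \<comment> \<open>Nonmeasurability passes from \<open>f\<close> to \<open>g\<close>, and both
    integrals take the default value \<open>0\<close>; so the equality holds without any
    measurability hypothesis.\<close>
  have "AE x in M. g x = f x" using eq by (auto simp: eq_commute)
  then have "g \<notin> borel_measurable M" using False borel_measurable_AE_eq by blast
  with False show ?thesis
    by (metis borel_measurable_integrable not_integrable_integral_eq)
qed

lemma (in complete_measure) square_integrable_AE_eq:
  assumes "square_integrable M f" and eq: "AE x in M. f x = g x"
  shows "square_integrable M g"
proof -
  have g: "g \<in> borel_measurable M"
    using borel_measurable_AE_eq[OF _ eq] assms(1) by (simp add: square_integrable_def)
  have "integrable M (\<lambda>x. (norm (g x))\<^sup>2)"
  proof (rule integrable_cong_AE_imp[OF square_integrable_norm[OF assms(1)]])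
    show "AE x in M. (norm (f x))\<^sup>2 = (norm (g x))\<^sup>2" using eq by eventually_elim simp
  qed (use g in simp)
  with g show ?thesis by (simp add: square_integrable_def)
qed

lemma (in complete_measure) L2sq_AE_eq: "AE x in M. f x = g x \<Longrightarrow> L2sq M f = L2sq M g"
  unfolding L2sq_def by (rule integral_AE_eq) auto

lemma complete_measure_lebesgue_on: "S \<in> sets lebesgue \<Longrightarrow> complete_measure (lebesgue_on S)"
  by (rule complete_measure_restrict_space) (auto intro: completion.complete_measure_axioms)

text \<open>The field enters the definition only through its square integrability and through
  integrals against test fields, both insensitive to null sets.\<close>

lemma has_weak_grad_AE_eq:
  assumes "open \<Omega>" and eq: "AE x in lebesgue_on \<Omega>. v x = w x"
  shows "has_weak_grad \<Omega> v G = has_weak_grad \<Omega> w G"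
proof -
  interpret complete_measure "lebesgue_on \<Omega>"
    using assms by (intro complete_measure_lebesgue_on) auto
  have eq': "AE x in lebesgue_on \<Omega>. w x = v x" using eq by (auto simp: eq_commute)
  have "square_integrable (lebesgue_on \<Omega>) v = square_integrable (lebesgue_on \<Omega>) w"
    using square_integrable_AE_eq[OF _ eq] square_integrable_AE_eq[OF _ eq'] by blast
  moreover have "(\<integral>x. v x \<bullet> classical_tensor_div \<Phi> x \<partial>lebesgue_on \<Omega>)
      = (\<integral>x. w x \<bullet> classical_tensor_div \<Phi> x \<partial>lebesgue_on \<Omega>)" for \<Phi>
    by (rule integral_AE_eq) (use eq in auto)
  ultimately show ?thesis by (simp add: has_weak_grad_def)
qed

text \<open>
  Fields that agree almost everywhere have the same weak gradients, hence \<^const>\<open>weak_grad\<close> selects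
  the same one for both.
\<close>
lemma S_normsq_AE_eq:
  assumes "open \<Omega>" "AE x in lebesgue_on \<Omega>. v x = w x"
  shows "S_normsq L1 L2 \<Omega> v = S_normsq L1 L2 \<Omega> w"
proof -
  have "weak_grad \<Omega> v = weak_grad \<Omega> w"
    by (simp add: weak_grad_def has_weak_grad_AE_eq[OF assms])
  then show ?thesis by (simp add: S_normsq_def weak_div_def[abs_def] sym_grad_def[abs_def])
qed

lemma square_integrable_restrict_space:
  assumes "square_integrable M f" "S \<in> sets M"
  shows "square_integrable (restrict_space M S) f"
  using assms integrable_mult_indicator[OF assms(2) square_integrable_norm[OF assms(1)]]
  by (auto simp: square_integrable_def measurable_restrict_space1 integrable_restrict_space)

lemma L2sq_restrict_space_le:
  assumes "square_integrable M f" "S \<in> sets M"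
  shows "L2sq (restrict_space M S) f \<le> L2sq M f"
  unfolding L2sq_def using assms integrable_mult_indicator[OF assms(2) square_integrable_norm[OF assms(1)]]
  by (subst integral_restrict_space)
     (auto intro!: integral_mono square_integrable_norm split: split_indicator)

lemma L2sq_eq_0D:
  assumes "square_integrable M f" "L2sq M f = 0"
  shows "AE x in M. f x = 0"
proof -
  have "AE x in M. (norm (f x))\<^sup>2 = 0"
    using assms unfolding L2sq_def by (subst (asm) integral_nonneg_eq_0_iff_AE) (auto intro:
      square_integrable_norm)
  then show ?thesis by simp
qed

section \<open>The surface measure and its restriction to pieces of the boundary\<close>

lemma sets_hausdorff_measure: "sets (hausdorff_measure k :: 'a::metric_space measure) = sets borel"
  unfolding hausdorff_measure_def
  using sets.sigma_sets_eq[of "borel :: 'a measure"] by (simp add: space_borel)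

lemma space_hausdorff_measure: "space (hausdorff_measure k :: 'a::metric_space measure) = UNIV"
  using sets_eq_imp_space_eq[OF sets_hausdorff_measure[where 'a='a]] by simp

lemma space_surface_on: "space (surface_on B) = B"
  by (simp add: surface_on_def space_restrict_space space_hausdorff_measure)

lemma borel_in_sets_surface_on:
  assumes "A \<in> sets borel" "B \<in> sets borel" "A \<subseteq> B"
  shows "A \<in> sets (surface_on B)"
  unfolding surface_on_def using assms
  by (auto simp: sets_restrict_space_iff space_hausdorff_measure sets_hausdorff_measure)

text \<open>Traces and the divergence theorem live on the full boundary, the interface terms on
  \<open>\<Sigma>\<close>; this presents the second measure as a restriction of the first.\<close>

lemma surface_on_subset:
  assumes "A \<in> sets borel" "B \<in> sets borel" "A \<subseteq> B"
  shows "surface_on A = restrict_space (surface_on B) A"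
  unfolding surface_on_def using assms
  by (subst restrict_restrict_space) (auto simp: space_hausdorff_measure sets_hausdorff_measure
    Int_absorb1 sets_completionI_sets)

lemma complete_measure_surface_on: "B \<in> sets borel \<Longrightarrow> complete_measure (surface_on B)"
  unfolding surface_on_def
  by (rule complete_measure_restrict_space)
     (auto intro: completion.complete_measure_axioms simp: sets_hausdorff_measure sets_completionI_sets)

lemma borel_measurable_surface_on:
  assumes "f \<in> borel_measurable borel"
  shows "f \<in> borel_measurable (surface_on B)"
  unfolding surface_on_def
  using assms by (intro measurable_restrict_space1 measurable_completion)
     (simp add: measurable_cong_sets[OF sets_hausdorff_measure refl])

text \<open>With two different normals, a short step from \<open>x\<close> in the direction
  \<open>\<nu>2 - \<nu>1\<close> would land in the inner cone of the first and in the outer cone of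
  the second. Uniqueness makes the description in \<open>outer_normal\<close> denote the normal
  wherever one exists.\<close>

lemma outward_unit_normal_unique:
  assumes "outward_unit_normal \<Omega> x \<nu>1" "outward_unit_normal \<Omega> x \<nu>2"
  shows "\<nu>1 = \<nu>2"
proof (rule ccontr)
  assume ne: "\<nu>1 \<noteq> \<nu>2"
  define w where "w = \<nu>2 - \<nu>1"
  \<comment> \<open>\<open>w\<close> has inner product \<open>1 - \<nu>1 \<bullet> \<nu>2\<close>
    with \<open>\<nu>2\<close> and minus that with \<open>\<nu>1\<close>. Half of the corresponding
    cosine is a cone parameter that both strict inequalities satisfy.\<close>
  define c where "c = (1 - \<nu>1 \<bullet> \<nu>2) / (2 * norm w)"
  have n: "\<nu>1 \<bullet> \<nu>1 = 1" "\<nu>2 \<bullet> \<nu>2 = 1"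
    using assms by (auto simp: outward_unit_normal_def norm_eq_1)
  have w: "norm w > 0" using ne by (simp add: w_def)
  have "0 < w \<bullet> w" using w by simp
  also have "w \<bullet> w = 2 * (1 - \<nu>1 \<bullet> \<nu>2)" using n by (simp add: w_def inner_simps
    inner_commute)
  finally have pos: "1 - \<nu>1 \<bullet> \<nu>2 > 0" by simp
  then have c: "c > 0" using w by (simp add: c_def)
  obtain r1 where r1: "r1 > 0" "\<And>y. norm (y - x) < r1 \<Longrightarrow> (y - x) \<bullet> \<nu>1 <
    - c * norm (y - x) \<Longrightarrow> y \<in> \<Omega>"
    using assms(1) c unfolding outward_unit_normal_def by blast
  obtain r2 where r2: "r2 > 0" "\<And>y. norm (y - x) < r2 \<Longrightarrow> (y - x) \<bullet> \<nu>2 >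
    c * norm (y - x) \<Longrightarrow> y \<notin> \<Omega>"
    using assms(2) c unfolding outward_unit_normal_def by blast
  define s where "s = min r1 r2 / (2 * norm w)"
  have s: "s > 0" "s * norm w < r1" "s * norm w < r2" using r1(1) r2(1) w by (auto simp: s_def min_def)
  define y where "y = x + s *\<^sub>R w"
  have cw: "c * norm w < 1 - \<nu>1 \<bullet> \<nu>2" using w pos by (simp add: c_def)
  have "w \<bullet> \<nu>1 = - (1 - \<nu>1 \<bullet> \<nu>2)" "w \<bullet> \<nu>2 = 1 - \<nu>1
    \<bullet> \<nu>2" using n by (simp_all add: w_def inner_simps inner_commute)
  then have "w \<bullet> \<nu>1 < - c * norm w" "w \<bullet> \<nu>2 > c * norm w" using cw by auto
  then have "s * (w \<bullet> \<nu>1) < s * (- c * norm w)" "s * (w \<bullet> \<nu>2) > s * (c * norm w)"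
    using s(1) by (simp_all only: mult_strict_left_mono)
  then have "(y - x) \<bullet> \<nu>1 < - c * norm (y - x)" "(y - x) \<bullet> \<nu>2 > c * norm (y - x)"
    using s(1) by (simp_all add: y_def mult.assoc mult.left_commute)
  moreover have "norm (y - x) < r1" "norm (y - x) < r2" using s by (auto simp: y_def)
  ultimately show False using r1(2) r2(2) by blast
qed

lemma norm_outer_normal: "outward_unit_normal \<Omega> x \<nu> \<Longrightarrow> norm (outer_normal
  \<Omega> x) = 1"
  using the_equality[of "outward_unit_normal \<Omega> x" \<nu>] outward_unit_normal_unique
  unfolding outer_normal_def by (metis outward_unit_normal_def)

lemma regular_domain_frontier:
  assumes "regular_domain \<Omega>"
  shows "frontier \<Omega> \<in> sets borel" "finite_measure (surface_on (frontier \<Omega>))" "compact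
    (frontier \<Omega>)"
proof -
  show "frontier \<Omega> \<in> sets borel" by (simp add: borel_closed)
  show "finite_measure (surface_on (frontier \<Omega>))"
    using assms by (intro finite_measureI) (auto simp: regular_domain_def space_surface_on)
  show "compact (frontier \<Omega>)"
    using assms by (auto simp: regular_domain_def compact_frontier_bounded)
qed

section \<open>Integration by parts and traces\<close>

lemma jacobian_eqI:
  assumes "((f :: real^'n \<Rightarrow> real^'m) has_derivative (\<lambda>h. A *v h)) (at x)"
  shows "jacobian f (at x) = A"
  unfolding jacobian_def frechet_derivative_at[OF assms, symmetric]
  by (rule matrix_of_matrix_vector_mul)

lemma C1_field_has_derivative:
  "C1_field v \<Longrightarrow> (v has_derivative (\<lambda>h. jacobian v (at x) *v h)) (at x)"
  unfolding C1_field_def by (simp only: jacobian_works[symmetric])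

lemma C1_field_continuous: "C1_field v \<Longrightarrow> continuous_on S v"
  unfolding C1_field_def
  by (intro continuous_at_imp_continuous_on ballI differentiable_imp_continuous_within) blast

lemma C1_tensor_continuous: "C1_tensor S \<Longrightarrow> continuous_on B S"
  using continuous_on_vec_lambda[of B "\<lambda>i x. S x $ i"] C1_field_continuous
  unfolding C1_tensor_def by fastforce

lemma
  assumes "C1_field f" "C1_field g"
  shows jacobian_diff: "jacobian (\<lambda>x. f x - g x) (at x) = jacobian f (at x) - jacobian g (at x)"
    and C1_field_diff: "C1_field (\<lambda>x. f x - g x)"
proof -
  have d: "((\<lambda>x. f x - g x) has_derivative (\<lambda>h. (jacobian f (at x) - jacobian g (at x))
    *v h)) (at x)" for x
    using has_derivative_diff[OF assms[THEN C1_field_has_derivative]]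
    by (simp add: matrix_vector_mult_diff_rdistrib)
  then show j: "jacobian (\<lambda>x. f x - g x) (at x) = jacobian f (at x) - jacobian g (at x)" for x
    by (rule jacobian_eqI)
  show "C1_field (\<lambda>x. f x - g x)"
    using d assms unfolding C1_field_def j by (auto intro: continuous_intros simp: differentiable_def)
qed

lemma
  assumes "C1_field f"
  shows jacobian_scaleR: "jacobian (\<lambda>x. c *\<^sub>R f x) (at x) = c *\<^sub>R jacobian f (at x)"
    and C1_field_scaleR: "C1_field (\<lambda>x. c *\<^sub>R f x)"
proof -
  have d: "((\<lambda>x. c *\<^sub>R f x) has_derivative (\<lambda>h. (c *\<^sub>R jacobian f (at x))
    *v h)) (at x)" for x
    using has_derivative_scaleR_right[OF C1_field_has_derivative[OF assms]]
    by (simp add: scaleR_matrix_vector_assoc)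
  then show j: "jacobian (\<lambda>x. c *\<^sub>R f x) (at x) = c *\<^sub>R jacobian f (at x)" for x
    by (rule jacobian_eqI)
  show "C1_field (\<lambda>x. c *\<^sub>R f x)"
    using d assms unfolding C1_field_def j by (auto intro: continuous_intros simp: differentiable_def)
qed

lemma inner_matrix_sum: "(A :: real^'n^'m) \<bullet> B = (\<Sum>i\<in>UNIV. \<Sum>j\<in>UNIV. A $ i $ j
  * B $ i $ j)"
  by (simp add: inner_vec_def)

text \<open>\<open>v v* S\<close> is the transpose of \<open>S\<close> applied to \<open>v\<close>.
  Its flux through the boundary is the integral of \<open>(S n) \<bullet> v\<close>, so the product
  rule for its divergence turns the divergence theorem into Green's formula for tensors.\<close>

lemma
  fixes S :: "real^'d \<Rightarrow> real^'d^'d"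
  assumes S: "C1_tensor S" and v: "C1_field v"
  shows C1_field_vector_matrix: "C1_field (\<lambda>x. v x v* S x)"
    and classical_div_vector_matrix: "classical_div (\<lambda>x. v x v* S x) x
        = S x \<bullet> jacobian v (at x) + classical_tensor_div S x \<bullet> v x"
proof -
  \<comment> \<open>Entry \<open>(k, j)\<close> is the partial derivative in direction
    \<open>j\<close> of the component \<open>\<Sum>i. v_i * S_ik\<close>.\<close>
  let ?J = "\<lambda>x. \<chi> k j. \<Sum>i\<in>UNIV. v x $ i * jacobian (\<lambda>x. S x $ i) (at x) $
    k $ j + jacobian v (at x) $ i $ j * S x $ i $ k"
  have S': "C1_field (\<lambda>x. S x $ i)" for i using S by (simp add: C1_tensor_def)
  have d: "((\<lambda>x. v x v* S x) has_derivative (\<lambda>h. ?J x *v h)) (at x)" for x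
  proof -
    have "((\<lambda>x. \<Sum>i\<in>UNIV. v x $ i *\<^sub>R S x $ i) has_derivative
       (\<lambda>h. \<Sum>i\<in>UNIV. v x $ i *\<^sub>R (jacobian (\<lambda>x. S x $ i) (at x) *v h) +
         ((jacobian v (at x) *v h) $ i) *\<^sub>R S x $ i)) (at x)"
      by (intro has_derivative_sum has_derivative_scaleR C1_field_has_derivative S'
          bounded_linear.has_derivative[OF bounded_linear_vec_nth] v)
    moreover have "(\<lambda>x. v x v* S x) = (\<lambda>x. \<Sum>i\<in>UNIV. v x $ i *\<^sub>R S x $ i)"
      by (simp add: fun_eq_iff vec_eq_iff vector_matrix_mult_def mult.commute)
    moreover have "(\<Sum>i\<in>UNIV. v x $ i *\<^sub>R (jacobian (\<lambda>x. S x $ i) (at x) *v h) +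
      ((jacobian v (at x) *v h) $ i) *\<^sub>R S x $ i) = ?J x *v h" for h
    proof -
      have "(?J x *v h) $ k = (\<Sum>i\<in>UNIV. v x $ i *\<^sub>R (jacobian (\<lambda>x. S x $ i) (at
        x) *v h) + ((jacobian v (at x) *v h) $ i) *\<^sub>R S x $ i) $ k" for k
      proof -
        have "(?J x *v h) $ k = (\<Sum>j\<in>UNIV. \<Sum>i\<in>UNIV. (v x $ i * jacobian (\<lambda>x. S
          x $ i) (at x) $ k $ j + jacobian v (at x) $ i $ j * S x $ i $ k) * h $ j)"
          by (simp add: matrix_vector_mult_def sum_distrib_right)
        also have "\<dots> = (\<Sum>i\<in>UNIV. \<Sum>j\<in>UNIV. (v x $ i * jacobian (\<lambda>x. S x
          $ i) (at x) $ k $ j + jacobian v (at x) $ i $ j * S x $ i $ k) * h $ j)"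
          by (rule sum.swap)
        also have "\<dots> = (\<Sum>i\<in>UNIV. v x $ i *\<^sub>R (jacobian (\<lambda>x. S x $ i) (at
          x) *v h) + ((jacobian v (at x) *v h) $ i) *\<^sub>R S x $ i) $ k"
          by (simp add: matrix_vector_mult_def sum_distrib_left sum_distrib_right sum.distrib algebra_simps)
        finally show ?thesis .
      qed
      then show ?thesis by (simp add: vec_eq_iff)
    qed
    ultimately show ?thesis by simp
  qed
  then have j: "jacobian (\<lambda>x. v x v* S x) (at x) = ?J x" for x by (rule jacobian_eqI)
  have "continuous_on UNIV ?J"
    using S' v C1_field_continuous[OF v] C1_tensor_continuous[OF S]
    by (intro continuous_on_vec_lambda continuous_intros) (auto simp: C1_field_def)
  then show "C1_field (\<lambda>x. v x v* S x)"
    using d unfolding C1_field_def j by (auto simp: differentiable_def)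
  show "classical_div (\<lambda>x. v x v* S x) x
        = S x \<bullet> jacobian v (at x) + classical_tensor_div S x \<bullet> v x"
  proof -
    have "classical_div (\<lambda>x. v x v* S x) x = (\<Sum>k\<in>UNIV. \<Sum>i\<in>UNIV. v x $ i *
      jacobian (\<lambda>x. S x $ i) (at x) $ k $ k)
        + (\<Sum>k\<in>UNIV. \<Sum>i\<in>UNIV. jacobian v (at x) $ i $ k * S x $ i $ k)"
      by (simp add: classical_div_def j trace_def sum.distrib)
    also have "(\<Sum>k\<in>UNIV. \<Sum>i\<in>UNIV. v x $ i * jacobian (\<lambda>x. S x $ i) (at x) $ k
      $ k) = classical_tensor_div S x \<bullet> v x"
      by (subst sum.swap) (simp add: classical_tensor_div_def classical_div_def trace_def inner_vec_def
        sum_distrib_left sum_distrib_right mult.commute)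
    also have "(\<Sum>k\<in>UNIV. \<Sum>i\<in>UNIV. jacobian v (at x) $ i $ k * S x $ i $ k) = S x
      \<bullet> jacobian v (at x)"
      by (subst sum.swap) (simp add: inner_matrix_sum mult.commute)
    finally show ?thesis by simp
  qed
qed

text \<open>\<open>S\<close> is bounded on the compact boundary, the normal has length one almost
  everywhere and the surface has finite area.\<close>

lemma square_integrable_normal_component:
  fixes S :: "real^'d \<Rightarrow> real^'d^'d"
  assumes \<Omega>: "regular_domain \<Omega>" and S: "continuous_on UNIV S"
  shows "square_integrable (surface_on (frontier \<Omega>)) (\<lambda>x. S x *v outer_normal \<Omega> x)"
proof -
  let ?M = "surface_on (frontier \<Omega>)"
  interpret finite_measure ?M by (rule regular_domain_frontier[OF \<Omega>])
  have "S \<in> borel_measurable ?M" by (intro borel_measurable_surface_on borel_measurable_continuous_onI S)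
  moreover have n: "outer_normal \<Omega> \<in> borel_measurable ?M" using \<Omega> by (simp add:
    regular_domain_def)
  ultimately have m: "(\<lambda>x. S x *v outer_normal \<Omega> x) \<in> borel_measurable ?M"
    by (rule borel_measurable_continuous_Pair)
       (unfold matrix_vector_mult_def, intro continuous_on_vec_lambda continuous_intros)
  have "bounded (S ` frontier \<Omega>)"
    by (intro compact_imp_bounded compact_continuous_image continuous_on_subset[OF S]
      regular_domain_frontier \<Omega>) auto
  then obtain K where K: "\<And>x. x \<in> frontier \<Omega> \<Longrightarrow> norm (S x) \<le> K" by
    (auto simp: bounded_iff)
  \<comment> \<open>Cauchy-Schwarz in each row: the Frobenius norm dominates the operator
    norm.\<close>
  have Sn: "norm (A *v y) \<le> norm A * norm y" for A :: "real^'d^'d" and y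
  proof -
    have "norm (A *v y) = L2_set (\<lambda>i. \<bar>A $ i \<bullet> y\<bar>) UNIV"
      by (simp add: norm_vec_def matrix_vector_mul_component)
    also have "\<dots> \<le> L2_set (\<lambda>i. norm (A $ i) * norm y) UNIV"
      by (intro L2_set_mono Cauchy_Schwarz_ineq2) auto
    also have "\<dots> = norm A * norm y"
      by (simp add: L2_set_left_distrib norm_vec_def[of A])
    finally show ?thesis .
  qed
  have "AE x in ?M. norm ((norm (S x *v outer_normal \<Omega> x))\<^sup>2) \<le> norm (K\<^sup>2)"
  proof -
    have "AE x in ?M. \<exists>\<nu>. outward_unit_normal \<Omega> x \<nu>" using \<Omega> by (simp
      add: regular_domain_def)
    with AE_space show ?thesis
    proof eventually_elim
      case (elim x)
      then have "norm (S x) \<le> K" "norm (outer_normal \<Omega> x) = 1"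
        using K norm_outer_normal by (auto simp: space_surface_on)
      then have "norm (S x *v outer_normal \<Omega> x) \<le> K"
        using Sn[of "S x" "outer_normal \<Omega> x"] by simp
      then show ?case by (simp add: power_mono)
    qed
  qed
  with m have "integrable ?M (\<lambda>x. (norm (S x *v outer_normal \<Omega> x))\<^sup>2)"
    using Bochner_Integration.integrable_bound[of ?M "\<lambda>_. K\<^sup>2" "\<lambda>x. (norm (S x *v
      outer_normal \<Omega> x))\<^sup>2"] by simp
  with m show ?thesis by (simp add: square_integrable_def)
qed

text \<open>
  The approximations of the traction converge on \<open>\<Sigma>\<close> only, so the velocity is taken to its limit
  first: its trace vanishes on the rest of the boundary.
\<close>
lemma integration_by_parts:
  fixes v :: "real^'d \<Rightarrow> real^'d"
  assumes \<Omega>: "regular_domain \<Omega>" and \<Sigma>: "closed \<Sigma>" "\<Sigma> \<subseteq>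
    frontier \<Omega>"
    and v: "H1_with_trace \<Omega> v" "AE x in surface_on (frontier \<Omega> - \<Sigma>). v x = 0"
    and S: "has_normal_trace \<Omega> \<Sigma> S f \<tau>"
  shows "(\<integral>x. S x \<bullet> weak_grad \<Omega> v x \<partial>lebesgue_on \<Omega>) +
    (\<integral>x. f x \<bullet> v x \<partial>lebesgue_on \<Omega>)
      = (\<integral>x. \<tau> x \<bullet> v x \<partial>surface_on \<Sigma>)"
proof -
  let ?L = "lebesgue_on \<Omega>" and ?M = "surface_on (frontier \<Omega>)"
  obtain vs where vs': "\<forall>l. C1_field (vs l)" "L2_converges ?L vs v"
    "L2_converges ?L (\<lambda>l x. jacobian (vs l) (at x)) (weak_grad \<Omega> v)" "L2_converges ?M vs v"
    using v(1) unfolding H1_with_trace_def by blast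
  have vs: "C1_field (vs l)" "L2_tendsto ?L vs v sequentially"
    "L2_tendsto ?L (\<lambda>l x. jacobian (vs l) (at x)) (weak_grad \<Omega> v) sequentially"
      "L2_tendsto ?M vs v sequentially"
    and vsi: "square_integrable ?L (vs l)" "square_integrable ?L (\<lambda>x. jacobian (vs l) (at x))" for l
    using vs' by (auto intro: L2_converges_imp_tendsto) (auto simp: L2_converges_def)
  obtain Ss where Ss': "\<forall>k. C1_tensor (Ss k)" "L2_converges ?L Ss S"
    "L2_converges ?L (\<lambda>k. classical_tensor_div (Ss k)) f"
    "L2_converges (surface_on \<Sigma>) (\<lambda>k x. Ss k x *v outer_normal \<Omega> x) \<tau>"
    using S unfolding has_normal_trace_def by blast
  have Ss: "C1_tensor (Ss k)" "L2_tendsto ?L Ss S sequentially"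
    "L2_tendsto ?L (\<lambda>k. classical_tensor_div (Ss k)) f sequentially"
    "L2_tendsto (surface_on \<Sigma>) (\<lambda>k x. Ss k x *v outer_normal \<Omega> x) \<tau> sequentially"
    and Ssi: "square_integrable ?L (Ss k)" "square_integrable ?L (classical_tensor_div (Ss k))" for k
    using Ss' by (auto intro: L2_converges_imp_tendsto) (auto simp: L2_converges_def)
  have borel: "\<Sigma> \<in> sets borel" "frontier \<Omega> \<in> sets borel" "frontier \<Omega> -
    \<Sigma> \<in> sets borel"
    using \<Sigma> by (auto intro: borel_closed)
  have \<Sigma>M: "\<Sigma> \<inter> space ?M \<in> sets ?M" "(frontier \<Omega> - \<Sigma>) \<inter>
    space ?M \<in> sets ?M"
    using \<Sigma>(2) borel by (auto simp: space_surface_on Int_absorb2 Diff_Int_distrib2 intro!: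
      borel_in_sets_surface_on)
  have sub: "surface_on \<Sigma> = restrict_space ?M \<Sigma>" "surface_on (frontier \<Omega> -
    \<Sigma>) = restrict_space ?M (frontier \<Omega> - \<Sigma>)"
    using borel \<Sigma>(2) by (auto intro: surface_on_subset)
  have v0: "AE x in ?M. x \<in> frontier \<Omega> - \<Sigma> \<longrightarrow> v x = 0"
    using v(2) AE_restrict_space_iff[OF \<Sigma>M(2)] unfolding sub by simp
  have vM: "square_integrable ?M v" using vs(4) by (simp add: L2_tendsto_def)
  then have v\<Sigma>: "square_integrable (surface_on \<Sigma>) v"
    unfolding sub using borel \<Sigma>(2) by (intro square_integrable_restrict_space borel_in_sets_surface_on)
  have eq: "(\<integral>x. Ss k x \<bullet> weak_grad \<Omega> v x \<partial>?L) + (\<integral>x.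
    classical_tensor_div (Ss k) x \<bullet> v x \<partial>?L)
      = (\<integral>x. (Ss k x *v outer_normal \<Omega> x) \<bullet> v x \<partial>surface_on \<Sigma>)" for k
  proof -
    define n where "n x = Ss k x *v outer_normal \<Omega> x" for x
    have n: "square_integrable ?M n"
      unfolding n_def[abs_def] by (intro square_integrable_normal_component \<Omega> C1_tensor_continuous Ss)
    have "(\<integral>x. Ss k x \<bullet> jacobian (vs l) (at x) \<partial>?L) + (\<integral>x.
      classical_tensor_div (Ss k) x \<bullet> vs l x \<partial>?L)
       = (\<integral>x. n x \<bullet> vs l x \<partial>?M)" for l
    proof -
      have "(\<integral>x. Ss k x \<bullet> jacobian (vs l) (at x) \<partial>?L) + (\<integral>x.
        classical_tensor_div (Ss k) x \<bullet> vs l x \<partial>?L)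
         = (\<integral>x. classical_div (\<lambda>x. vs l x v* Ss k x) x \<partial>?L)"
        by (simp add: classical_div_vector_matrix Ss vs square_integrable_inner Ssi vsi)
      also have "\<dots> = (\<integral>x. (vs l x v* Ss k x) \<bullet> outer_normal \<Omega> x \<partial>?M)"
        using \<Omega> C1_field_vector_matrix[OF Ss(1) vs(1)] unfolding regular_domain_def by blast
      also have "\<dots> = (\<integral>x. n x \<bullet> vs l x \<partial>?M)"
        by (simp only: n_def dot_lmul_matrix) (simp add: inner_commute)
      finally show ?thesis .
    qed
    moreover have "(\<lambda>l. (\<integral>x. Ss k x \<bullet> jacobian (vs l) (at x) \<partial>?L) +
      (\<integral>x. classical_tensor_div (Ss k) x \<bullet> vs l x \<partial>?L))
        \<longlonglongrightarrow> (\<integral>x. Ss k x \<bullet> weak_grad \<Omega> v x \<partial>?L)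
          + (\<integral>x. classical_tensor_div (Ss k) x \<bullet> v x \<partial>?L)"
      by (intro tendsto_add L2_tendsto_inner L2_tendsto_const vs Ssi)
    moreover have "(\<lambda>l. \<integral>x. n x \<bullet> vs l x \<partial>?M)
      \<longlonglongrightarrow> (\<integral>x. n x \<bullet> v x \<partial>?M)"
      by (intro L2_tendsto_inner L2_tendsto_const vs n)
    ultimately have "(\<integral>x. Ss k x \<bullet> weak_grad \<Omega> v x \<partial>?L) +
      (\<integral>x. classical_tensor_div (Ss k) x \<bullet> v x \<partial>?L)
        = (\<integral>x. n x \<bullet> v x \<partial>?M)"
      using LIMSEQ_unique by simp
    also have "\<dots> = (\<integral>x. indicator \<Sigma> x *\<^sub>R (n x \<bullet> v x) \<partial>?M)"
    proof (rule integral_cong_AE)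
      show "AE x in ?M. n x \<bullet> v x = indicator \<Sigma> x *\<^sub>R (n x \<bullet> v x)"
        using v0 AE_space by eventually_elim (auto simp: space_surface_on split: split_indicator)
      have "\<Sigma> \<in> sets ?M" using borel \<Sigma>(2) by (intro borel_in_sets_surface_on)
      then show "(\<lambda>x. indicator \<Sigma> x *\<^sub>R (n x \<bullet> v x)) \<in> borel_measurable ?M"
        using square_integrable_inner[OF n vM] by (intro borel_measurable_scaleR
          borel_measurable_indicator) auto
    qed (use square_integrable_inner[OF n vM] in auto)
    also have "\<dots> = (\<integral>x. n x \<bullet> v x \<partial>surface_on \<Sigma>)"
      unfolding sub by (rule integral_restrict_space[symmetric]) (rule \<Sigma>M)
    finally show ?thesis by (simp add: n_def)
  qed
  \<comment> \<open>The second limit, in \<open>k\<close>: the boundary integral now runs over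
    \<open>\<Sigma>\<close> alone, which is where the tractions converge.\<close>
  have "(\<lambda>k. (\<integral>x. Ss k x \<bullet> weak_grad \<Omega> v x \<partial>?L) +
    (\<integral>x. classical_tensor_div (Ss k) x \<bullet> v x \<partial>?L))
      \<longlonglongrightarrow> (\<integral>x. S x \<bullet> weak_grad \<Omega> v x \<partial>?L) +
        (\<integral>x. f x \<bullet> v x \<partial>?L)"
    using vs(2,3) by (intro tendsto_add L2_tendsto_inner L2_tendsto_const Ss) (auto simp: L2_tendsto_def)
  moreover have "(\<lambda>k. \<integral>x. (Ss k x *v outer_normal \<Omega> x) \<bullet> v x
    \<partial>surface_on \<Sigma>)
     \<longlonglongrightarrow> (\<integral>x. \<tau> x \<bullet> v x \<partial>surface_on \<Sigma>)"
    by (intro L2_tendsto_inner L2_tendsto_const Ss v\<Sigma>)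
  ultimately show ?thesis using LIMSEQ_unique by (simp add: eq)
qed

text \<open>
  As \<^const>\<open>H1_with_trace\<close>, but with an explicit gradient, so that it is evidently linear.
\<close>
definition H1_approx :: "(real^'d) set \<Rightarrow> (real^'d \<Rightarrow> real^'d) \<Rightarrow>
  (real^'d \<Rightarrow> real^'d^'d) \<Rightarrow> bool" where
  "H1_approx \<Omega> v G \<longleftrightarrow> (\<exists>vs. (\<forall>k. C1_field (vs k)) \<and>
        L2_tendsto (lebesgue_on \<Omega>) vs v sequentially \<and>
        L2_tendsto (lebesgue_on \<Omega>) (\<lambda>k x. jacobian (vs k) (at x)) G sequentially \<and>
        L2_tendsto (surface_on (frontier \<Omega>)) vs v sequentially)"

lemma H1_with_trace_imp_approx: "H1_with_trace \<Omega> v \<Longrightarrow> H1_approx \<Omega> v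
  (weak_grad \<Omega> v)"
  unfolding H1_with_trace_def H1_approx_def by (blast intro: L2_converges_imp_tendsto)

lemma H1_approx_diff:
  assumes "H1_approx \<Omega> v G" "H1_approx \<Omega> w H"
  shows "H1_approx \<Omega> (\<lambda>x. v x - w x) (\<lambda>x. G x - H x)"
proof -
  obtain vs ws where "\<And>k. C1_field (vs k)" "\<And>k. C1_field (ws k)"
    "L2_tendsto (lebesgue_on \<Omega>) vs v sequentially" "L2_tendsto (lebesgue_on \<Omega>) ws w
      sequentially"
    "L2_tendsto (lebesgue_on \<Omega>) (\<lambda>k x. jacobian (vs k) (at x)) G sequentially"
    "L2_tendsto (lebesgue_on \<Omega>) (\<lambda>k x. jacobian (ws k) (at x)) H sequentially"
    "L2_tendsto (surface_on (frontier \<Omega>)) vs v sequentially"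
    "L2_tendsto (surface_on (frontier \<Omega>)) ws w sequentially"
    using assms unfolding H1_approx_def by blast
  then show ?thesis
    unfolding H1_approx_def
    by (intro exI[of _ "\<lambda>k x. vs k x - ws k x"]) (auto simp: jacobian_diff intro: C1_field_diff
      L2_tendsto_diff)
qed

lemma H1_approx_scaleR:
  assumes "H1_approx \<Omega> v G"
  shows "H1_approx \<Omega> (\<lambda>x. c *\<^sub>R v x) (\<lambda>x. c *\<^sub>R G x)"
proof -
  obtain vs where "\<And>k. C1_field (vs k)"
    "L2_tendsto (lebesgue_on \<Omega>) vs v sequentially"
    "L2_tendsto (lebesgue_on \<Omega>) (\<lambda>k x. jacobian (vs k) (at x)) G sequentially"
    "L2_tendsto (surface_on (frontier \<Omega>)) vs v sequentially"
    using assms unfolding H1_approx_def by blast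
  then show ?thesis
    unfolding H1_approx_def
    by (intro exI[of _ "\<lambda>k x. c *\<^sub>R vs k x"]) (auto simp: jacobian_scaleR intro:
      C1_field_scaleR L2_tendsto_scaleR)
qed

text \<open>For smooth fields the bound is part of \<open>regular_domain\<close>, and all three
  norms pass to the limit along the approximating sequence. One \<open>C\<close> serves every pair,
  as is needed for a whole family of difference quotients.\<close>

lemma H1_approx_trace_bound:
  assumes "regular_domain \<Omega>"
  obtains C where "\<And>v G. H1_approx \<Omega> v G \<Longrightarrow>
    L2sq (surface_on (frontier \<Omega>)) v \<le> C * (L2sq (lebesgue_on \<Omega>) v + L2sq
      (lebesgue_on \<Omega>) G)"
proof -
  obtain C where C: "\<And>v. C1_field v \<Longrightarrow> L2sq (surface_on (frontier \<Omega>)) v \<le>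
          C * (L2sq (lebesgue_on \<Omega>) v + L2sq (lebesgue_on \<Omega>) (\<lambda>x. jacobian v (at x)))"
    using assms unfolding regular_domain_def by blast
  show ?thesis
  proof
    fix v G assume "H1_approx \<Omega> v G"
    then obtain vs where vs: "\<And>k. C1_field (vs k)"
      "L2_tendsto (lebesgue_on \<Omega>) vs v sequentially"
      "L2_tendsto (lebesgue_on \<Omega>) (\<lambda>k x. jacobian (vs k) (at x)) G sequentially"
      "L2_tendsto (surface_on (frontier \<Omega>)) vs v sequentially"
      unfolding H1_approx_def by blast
    show "L2sq (surface_on (frontier \<Omega>)) v \<le> C * (L2sq (lebesgue_on \<Omega>) v + L2sq
      (lebesgue_on \<Omega>) G)"
    proof (rule LIMSEQ_le)
      show "(\<lambda>k. L2sq (surface_on (frontier \<Omega>)) (vs k)) \<longlonglongrightarrow> L2sq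
        (surface_on (frontier \<Omega>)) v"
        by (intro L2_tendsto_L2sq vs)
      show "(\<lambda>k. C * (L2sq (lebesgue_on \<Omega>) (vs k) + L2sq (lebesgue_on \<Omega>)
        (\<lambda>x. jacobian (vs k) (at x))))
         \<longlonglongrightarrow> C * (L2sq (lebesgue_on \<Omega>) v + L2sq (lebesgue_on \<Omega>) G)"
        by (intro tendsto_intros L2_tendsto_L2sq vs)
    qed (use C vs(1) in blast)
  qed
qed

lemma H1_with_trace_square_integrable:
  assumes "H1_with_trace \<Omega> v"
  shows "square_integrable (lebesgue_on \<Omega>) v" "square_integrable (lebesgue_on \<Omega>)
    (weak_grad \<Omega> v)"
    "square_integrable (surface_on (frontier \<Omega>)) v"
  using assms by (auto simp: H1_with_trace_def L2_converges_def)

text \<open>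
  The difference quotients vanish on \<open>\<Gamma>\<close> and converge in \<open>H\<^sup>1(\<Omega>)\<close>, so their traces converge as
  well.
\<close>
lemma trace_of_time_derivative_eq_0:
  fixes \<eta> :: "real \<Rightarrow> real^'d \<Rightarrow> real^'d"
  assumes \<Omega>: "regular_domain \<Omega>" and \<Gamma>: "\<Gamma> \<in> sets borel" "\<Gamma>
    \<subseteq> frontier \<Omega>" and "a < b" and t: "t \<in> {a..b}"
    and \<eta>: "\<And>s. s \<in> {a..b} \<Longrightarrow> H1_with_trace \<Omega> (\<eta> s)"
    and 0: "\<And>s. s \<in> {a..b} \<Longrightarrow> AE x in surface_on \<Gamma>. \<eta> s x = 0"
    and w: "H1_with_trace \<Omega> w"
    and d: "has_L2_deriv (lebesgue_on \<Omega>) \<eta> w (at t within {a..b}) t"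
    and dG: "has_L2_deriv (lebesgue_on \<Omega>) (\<lambda>s. weak_grad \<Omega> (\<eta> s)) (weak_grad
      \<Omega> w) (at t within {a..b}) t"
  shows "AE x in surface_on \<Gamma>. w x = 0"
proof -
  let ?L = "lebesgue_on \<Omega>" and ?M = "surface_on (frontier \<Omega>)" and ?F = "at t within {a..b}"
  have fr: "frontier \<Omega> \<in> sets borel" by (rule regular_domain_frontier[OF \<Omega>])
  have sub: "surface_on \<Gamma> = restrict_space ?M \<Gamma>" and \<Gamma>M: "\<Gamma> \<in> sets ?M"
    using \<Gamma> fr by (auto intro: surface_on_subset borel_in_sets_surface_on)
  have w\<Gamma>: "square_integrable (surface_on \<Gamma>) w"
    unfolding sub by (intro square_integrable_restrict_space \<Gamma>M H1_with_trace_square_integrable w)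
  obtain C where C: "\<And>v G. H1_approx \<Omega> v G \<Longrightarrow> L2sq ?M v \<le> C * (L2sq ?L v
    + L2sq ?L G)"
    using H1_approx_trace_bound[OF \<Omega>] by blast
  \<comment> \<open>The error of the difference quotient against \<open>w\<close>; \<open>r\<close>
    is the explicit gradient that belongs to it.\<close>
  define q where "q s x = (1 / (s - t)) *\<^sub>R (\<eta> s x - \<eta> t x) - w x" for s x
  define r where "r s x = (1 / (s - t)) *\<^sub>R (weak_grad \<Omega> (\<eta> s) x - weak_grad \<Omega>
    (\<eta> t) x) - weak_grad \<Omega> w x" for s x
  have "((\<lambda>s. L2sq ?L (q s)) \<longlongrightarrow> 0) ?F" "((\<lambda>s. L2sq ?L (r s))
    \<longlongrightarrow> 0) ?F"
    using d dG by (simp_all add: has_L2_deriv_def L2_dist_tendsto_0_iff q_def[abs_def] r_def[abs_def])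
  then have "((\<lambda>s. C * (L2sq ?L (q s) + L2sq ?L (r s))) \<longlongrightarrow> C * (0 + 0)) ?F"
    by (intro tendsto_intros)
  moreover have "\<forall>\<^sub>F s in ?F. s \<in> {a..b}" by (simp add: eventually_at_filter)
  then have "\<forall>\<^sub>F s in ?F. L2sq (surface_on \<Gamma>) w \<le> C * (L2sq ?L (q s) + L2sq ?L
    (r s))"
  proof eventually_elim
    case (elim s)
    have q: "H1_approx \<Omega> (q s) (r s)"
      unfolding q_def[abs_def] r_def[abs_def]
      by (intro H1_approx_diff H1_approx_scaleR H1_with_trace_imp_approx \<eta> w elim t)
    \<comment> \<open>On \<open>\<Gamma>\<close> the quotient vanishes, so \<open>q s\<close> is
      \<open>- w\<close> there for every \<open>s\<close>: a fixed norm is bounded by a quantity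
      tending to \<open>0\<close>.\<close>
    have "AE x in surface_on \<Gamma>. (-1) *\<^sub>R w x = q s x"
      using 0[OF elim] 0[OF t] by eventually_elim (simp add: q_def)
    then have "L2sq (surface_on \<Gamma>) (\<lambda>x. (-1) *\<^sub>R w x) = L2sq (surface_on \<Gamma>) (q s)"
      by (rule complete_measure.L2sq_AE_eq[OF complete_measure_surface_on[OF \<Gamma>(1)]])
    then have "L2sq (surface_on \<Gamma>) w = L2sq (surface_on \<Gamma>) (q s)"
      by (simp only: L2sq_scaleR) simp
    also have "\<dots> \<le> L2sq ?M (q s)"
      unfolding sub using q by (intro L2sq_restrict_space_le \<Gamma>M) (auto simp: H1_approx_def
        L2_tendsto_def)
    also have "\<dots> \<le> C * (L2sq ?L (q s) + L2sq ?L (r s))" by (rule C[OF q])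
    finally show ?case .
  qed
  \<comment> \<open>Here \<open>a < b\<close> matters: \<open>t\<close> must be an accumulation
    point of the interval.\<close>
  moreover have "?F \<noteq> bot"
    using t \<open>a < b\<close> by (simp add: trivial_limit_within islimpt_Icc)
  ultimately have "L2sq (surface_on \<Gamma>) w \<le> C * (0 + 0)" by (intro tendsto_lowerbound)
  then have "L2sq (surface_on \<Gamma>) w = 0" using L2sq_nonneg[of "surface_on \<Gamma>" w] by simp
  with w\<Gamma> show ?thesis by (rule L2sq_eq_0D)
qed

section \<open>Time averages\<close>

lemma finite_measure_lebesgue_on_Icc: "finite_measure (lebesgue_on {a..b::real})"
  by (rule finite_measure_lebesgue_on) simp

lemma measure_lebesgue_on_Icc: "a \<le> b \<Longrightarrow> measure (lebesgue_on {a..b::real}) (space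
  (lebesgue_on {a..b})) = b - a"
  by (simp add: measure_restrict_space)

lemma pair_sigma_finite_lebesgue_on_Icc:
  assumes "finite_measure M"
  shows "pair_sigma_finite (lebesgue_on {a..b::real}) M"
  using assms finite_measure_lebesgue_on_Icc[of a b]
  by (simp add: pair_sigma_finite_def finite_measure.axioms)

lemma L2_L2_integrable_inner:
  assumes M: "finite_measure M" and "L2_L2 M a b f" "L2_L2 M a b g"
  shows "integrable (lebesgue_on {a..b}) (\<lambda>t. \<integral>x. f t x \<bullet> g t x \<partial>M)"
proof -
  interpret pair_sigma_finite "lebesgue_on {a..b}" M by (rule pair_sigma_finite_lebesgue_on_Icc[OF M])
  show ?thesis
    using integrable_fst'[OF square_integrable_inner[OF assms(2,3)[unfolded L2_L2_def]]] by simp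
qed

lemma L2_L2_integrable_L2sq:
  "finite_measure M \<Longrightarrow> L2_L2 M a b f \<Longrightarrow> integrable (lebesgue_on {a..b})
    (\<lambda>t. L2sq M (f t))"
  unfolding L2sq_inner by (rule L2_L2_integrable_inner)

lemma L2_L2_AE_square_integrable:
  assumes M: "finite_measure M" and f: "L2_L2 M a b f"
  shows "AE t in lebesgue_on {a..b}. square_integrable M (f t)"
proof -
  interpret pair_sigma_finite "lebesgue_on {a..b}" M by (rule pair_sigma_finite_lebesgue_on_Icc[OF M])
  have "AE t in lebesgue_on {a..b}. integrable M (\<lambda>x. (norm (f t x))\<^sup>2)"
    using AE_integrable_fst'[OF square_integrable_norm[OF f[unfolded L2_L2_def]]] by simp
  then show ?thesis using AE_space
  proof eventually_elim
    case (elim t)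
    then show ?case
      using measurable_Pair2[OF square_integrable_measurable[OF f[unfolded L2_L2_def]], of t]
      by (simp add: square_integrable_def)
  qed
qed

lemma L2_L2_const:
  assumes M: "finite_measure M" and h: "square_integrable M h"
  shows "L2_L2 M a b (\<lambda>_. h)"
proof -
  interpret pair_sigma_finite "lebesgue_on {a..b}" M by (rule pair_sigma_finite_lebesgue_on_Icc[OF M])
  interpret I: finite_measure "lebesgue_on {a..b}" by (rule finite_measure_lebesgue_on_Icc)
  have m: "(\<lambda>p. h (snd p)) \<in> borel_measurable (lebesgue_on {a..b} \<Otimes>\<^sub>M M)"
    using measurable_compose[OF measurable_snd square_integrable_measurable[OF h]] .
  have "integrable (lebesgue_on {a..b} \<Otimes>\<^sub>M M) (\<lambda>p. (norm (h (snd p)))\<^sup>2)"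
    by (rule Fubini_integrable) (use m square_integrable_norm[OF h] in auto)
  with m show ?thesis by (simp add: L2_L2_def square_integrable_def case_prod_unfold)
qed

lemma L2_L2_diff:
  assumes "L2_L2 M a b f" "L2_L2 M a b g"
  shows "L2_L2 M a b (\<lambda>t x. f t x - g t x)"
  using square_integrable_diff[OF assms[unfolded L2_L2_def]] by (simp add: L2_L2_def case_prod_unfold)

text \<open>Cauchy-Schwarz against the constant \<open>1\<close>, whose squared norm on the interval
  is \<open>b - a\<close>; this is the Jensen bound at a single point of space.\<close>

lemma norm_integral_Icc_squared_le:
  fixes g :: "real \<Rightarrow> 'b::euclidean_space"
  assumes "a \<le> b" and g: "square_integrable (lebesgue_on {a..b}) g"
  shows "(norm (\<integral>s. g s \<partial>lebesgue_on {a..b}))\<^sup>2 \<le> (b - a) * (\<integral>s.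
    (norm (g s))\<^sup>2 \<partial>lebesgue_on {a..b})"
proof -
  let ?I = "lebesgue_on {a..b}"
  interpret finite_measure ?I by (rule finite_measure_lebesgue_on_Icc)
  have n: "square_integrable ?I (\<lambda>s. norm (g s))" and 1: "square_integrable ?I (\<lambda>s. 1::real)"
    using g by (auto simp: square_integrable_def)
  have "norm (\<integral>s. g s \<partial>?I) \<le> \<bar>\<integral>s. norm (g s) \<bullet> 1
    \<partial>?I\<bar>"
    using integral_norm_bound[of ?I g] by simp
  also have "\<dots> \<le> sqrt (L2sq ?I (\<lambda>s. norm (g s))) * sqrt (L2sq ?I (\<lambda>s. 1::real))"
    by (rule L2_Cauchy_Schwarz[OF n 1])
  also have "L2sq ?I (\<lambda>s. 1::real) = b - a"
    using measure_lebesgue_on_Icc[OF \<open>a \<le> b\<close>] by (simp add: L2sq_def)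
  finally have "(norm (\<integral>s. g s \<partial>?I))\<^sup>2 \<le> (sqrt (L2sq ?I (\<lambda>s. norm
    (g s))) * sqrt (b - a))\<^sup>2"
    by (intro power_mono) auto
  also have "\<dots> = (b - a) * (\<integral>s. (norm (g s))\<^sup>2 \<partial>?I)"
    using \<open>a \<le> b\<close> L2sq_nonneg[of ?I "\<lambda>s. norm (g s)"] by (simp add:
      power_mult_distrib L2sq_def mult.commute)
  finally show ?thesis .
qed

text \<open>The pointwise Jensen bound holds at almost every \<open>x\<close> and is integrated over
  \<open>M\<close>, with Fubini exchanging space and time. The factor \<open>b - a\<close> is the
  weight with which a datum constant in time appears in the slab balance.\<close>

lemma
  fixes f :: "real \<Rightarrow> 'a \<Rightarrow> 'b::euclidean_space"
  assumes M: "finite_measure M" and f: "L2_L2 M a b f" and "a < b"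
  defines "m \<equiv> \<lambda>x. (1 / (b - a)) *\<^sub>R (\<integral>s. f s x \<partial>lebesgue_on {a..b})"
  shows square_integrable_time_mean: "square_integrable M m"
    and L2sq_time_mean_le: "(b - a) * L2sq M m \<le> (\<integral>t. L2sq M (f t) \<partial>lebesgue_on
      {a..b})"
proof -
  let ?I = "lebesgue_on {a..b}"
  interpret pair_sigma_finite ?I M by (rule pair_sigma_finite_lebesgue_on_Icc[OF M])
  \<comment> \<open>The mean integrates over time at fixed \<open>x\<close>, so the product with
    exchanged factors is needed too.\<close>
  interpret Q: pair_sigma_finite M ?I ..
  have fm: "(\<lambda>p. f (fst p) (snd p)) \<in> borel_measurable (?I \<Otimes>\<^sub>M M)"
    and fi: "integrable (?I \<Otimes>\<^sub>M M) (\<lambda>(t,x). (norm (f t x))\<^sup>2)"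
    using f by (auto simp: L2_L2_def square_integrable_def case_prod_unfold)
  have fm': "(\<lambda>p. f (snd p) (fst p)) \<in> borel_measurable (M \<Otimes>\<^sub>M ?I)"
    using measurable_compose[OF measurable_pair_swap' fm] by (simp add: case_prod_unfold)
  have fi': "integrable (M \<Otimes>\<^sub>M ?I) (\<lambda>p. (norm (f (snd p) (fst p)))\<^sup>2)"
    using integrable_product_swap[OF fi] by (simp add: case_prod_unfold)
  have m: "m \<in> borel_measurable M"
    unfolding m_def using fm'
    by (intro borel_measurable_scaleR borel_measurable_const M1.borel_measurable_lebesgue_integral)
       (simp add: case_prod_unfold)
  define h where "h x = (\<integral>s. (norm (f s x))\<^sup>2 \<partial>?I)" for x
  have h: "integrable M h" unfolding h_def using Q.integrable_fst'[OF fi'] by simp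
  have "AE x in M. integrable ?I (\<lambda>s. (norm (f s x))\<^sup>2)" using Q.AE_integrable_fst'[OF
    fi'] by simp
  then have le: "AE x in M. (b - a) * (norm (m x))\<^sup>2 \<le> h x" using AE_space
  proof eventually_elim
    case (elim x)
    then have "square_integrable ?I (\<lambda>s. f s x)"
      using measurable_Pair2[OF fm', of x] by (simp add: square_integrable_def)
    then have "(norm (\<integral>s. f s x \<partial>?I))\<^sup>2 \<le> (b - a) * h x"
      unfolding h_def using \<open>a < b\<close> by (intro norm_integral_Icc_squared_le) auto
    then have "(norm (\<integral>s. f s x \<partial>?I))\<^sup>2 / (b - a) \<le> h x"
      using \<open>a < b\<close> by (simp add: pos_divide_le_eq mult.commute)
    moreover have "(b - a) * (norm (m x))\<^sup>2 = (norm (\<integral>s. f s x \<partial>?I))\<^sup>2 /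
      (b - a)"
      using \<open>a < b\<close> by (simp add: m_def power_divide) (simp add: power2_eq_square)
    ultimately show ?case by simp
  qed
  have mi: "integrable M (\<lambda>x. (b - a) * (norm (m x))\<^sup>2)"
  proof (rule Bochner_Integration.integrable_bound[OF h])
    show "AE x in M. norm ((b - a) * (norm (m x))\<^sup>2) \<le> norm (h x)"
      using le by eventually_elim (use \<open>a < b\<close> in \<open>simp add: h_def\<close>)
  qed (use m in simp)
  then have "integrable M (\<lambda>x. (norm (m x))\<^sup>2)" using \<open>a < b\<close> by simp
  with m show "square_integrable M m" by (simp add: square_integrable_def)
  have "(b - a) * L2sq M m = (\<integral>x. (b - a) * (norm (m x))\<^sup>2 \<partial>M)" by (simp add:
    L2sq_def)
  also have "\<dots> \<le> (\<integral>x. h x \<partial>M)" by (rule integral_mono_AE[OF mi h le])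
  also have "\<dots> = (\<integral>t. L2sq M (f t) \<partial>?I)"
    unfolding h_def L2sq_def using Fubini_integral[OF fi] by simp
  finally show "(b - a) * L2sq M m \<le> (\<integral>t. L2sq M (f t) \<partial>?I)" .
qed

section \<open>Energy balances\<close>

lemma bounded_linear_matrix_sym:
  "bounded_linear (\<lambda>X :: real^'d^'d. (1/2) *\<^sub>R (X + transpose X))"
  by (rule linear_conv_bounded_linear[THEN iffD1], rule linearI)
     (simp_all add: transpose_def vec_eq_iff algebra_simps)

lemma bounded_linear_trace: "bounded_linear (trace :: real^'d^'d \<Rightarrow> real)"
  by (rule linear_conv_bounded_linear[THEN iffD1], rule linearI)
     (simp_all add: trace_def sum.distrib sum_distrib_left)

lemma inner_transpose: "transpose (A :: real^'d^'d) \<bullet> transpose B = A \<bullet> B"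
  by (simp add: inner_matrix_sum transpose_def sum.swap[of "\<lambda>i j. A $ j $ i * B $ j $ i"])

lemma inner_mat_1: "(mat 1 :: real^'d^'d) \<bullet> A = trace A"
  by (simp add: inner_matrix_sum mat_def trace_def if_distrib[of "\<lambda>x. x * _"] cong: if_cong)

text \<open>A symmetric matrix is orthogonal to every skew one, so it sees only the symmetric part
  of \<open>B\<close>. For gradients this reduces stress against gradient to strain against
  strain.\<close>

lemma inner_matrix_sym:
  fixes A B :: "real^'d^'d"
  shows "((1/2) *\<^sub>R (A + transpose A)) \<bullet> B = ((1/2) *\<^sub>R (A + transpose A))
    \<bullet> ((1/2) *\<^sub>R (B + transpose B))"
proof -
  \<comment> \<open>\<open>p\<close>, \<open>q\<close>, \<open>r\<close>, \<open>s\<close> stand for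
    the pairings of \<open>A\<close> with \<open>B\<close>, of \<open>transpose A\<close> with
    \<open>B\<close>, of \<open>A\<close> with \<open>transpose B\<close>, and of the two
    transposes.\<close>
  have average: "1 / 2 * (p + q) = 1 / 2 * (1 / 2 * (p + q) + 1 / 2 * (r + s))" if "q = r" "p = s" for
    p q r s :: real
    using that by (simp add: field_simps)
  have "transpose A \<bullet> B = A \<bullet> transpose B" "A \<bullet> B = transpose A \<bullet> transpose B"
    using inner_transpose[of "transpose A" B] inner_transpose[of A B] by simp_all
  then show ?thesis
    unfolding inner_add_left inner_add_right inner_scaleR_left inner_scaleR_right
    by (rule average)
qed

lemma sym_grad_inner_weak_grad:
  "sym_grad \<Omega> v x \<bullet> weak_grad \<Omega> w x = sym_grad \<Omega> v x \<bullet> sym_grad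
    \<Omega> w x"
  unfolding sym_grad_def by (rule inner_matrix_sym)

lemma solid_stress_inner:
  "solid_stress L1 L2 \<Omega> \<eta> x \<bullet> weak_grad \<Omega> w x
     = 2 * L1 * (sym_grad \<Omega> \<eta> x \<bullet> sym_grad \<Omega> w x) + L2 * (weak_div \<Omega>
       \<eta> x * weak_div \<Omega> w x)"
  by (simp add: solid_stress_def inner_add_left sym_grad_inner_weak_grad inner_mat_1 weak_div_def)

lemma fluid_stress_inner:
  "fluid_stress \<mu> \<Omega> u p x \<bullet> weak_grad \<Omega> u x
     = 2 * \<mu> * (sym_grad \<Omega> u x \<bullet> sym_grad \<Omega> u x) - p x * weak_div \<Omega> u x"
  by (simp add: fluid_stress_def inner_diff_left sym_grad_inner_weak_grad inner_mat_1 weak_div_def)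

lemma
  assumes "square_integrable (lebesgue_on \<Omega>) (weak_grad \<Omega> v)"
  shows square_integrable_sym_grad: "square_integrable (lebesgue_on \<Omega>) (sym_grad \<Omega> v)"
    and square_integrable_weak_div: "square_integrable (lebesgue_on \<Omega>) (weak_div \<Omega> v)"
  using square_integrable_bounded_linear[OF bounded_linear_matrix_sym assms]
    square_integrable_bounded_linear[OF bounded_linear_trace assms]
  by (simp_all add: sym_grad_def[abs_def] weak_div_def[abs_def])

text \<open>The stress pairing is the bilinear form that polarizes \<open>S_normsq\<close>; the
  factor \<open>1 / 2\<close> cancels the \<open>2\<close> from differentiating squares.\<close>

lemma S_normsq_deriv:
  fixes \<eta> :: "real \<Rightarrow> real^'d \<Rightarrow> real^'d"
  assumes ev: "L2_evolution (lebesgue_on \<Omega>) a b (\<lambda>s. weak_grad \<Omega> (\<eta> s))" and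
    t: "t \<in> {a..b}"
    and d: "has_L2_deriv (lebesgue_on \<Omega>) (\<lambda>s. weak_grad \<Omega> (\<eta> s)) (weak_grad
      \<Omega> w) (at t within {a..b}) t"
  shows "((\<lambda>s. 1 / 2 * S_normsq L1 L2 \<Omega> (\<eta> s)) has_real_derivative
     (\<integral>x. solid_stress L1 L2 \<Omega> (\<eta> t) x \<bullet> weak_grad \<Omega> w x
       \<partial>lebesgue_on \<Omega>)) (at t within {a..b})"
proof -
  let ?L = "lebesgue_on \<Omega>"
  have si: "square_integrable ?L (weak_grad \<Omega> (\<eta> t))" "square_integrable ?L (weak_grad
    \<Omega> w)"
    using ev t d by (auto simp: L2_evolution_def has_L2_deriv_def)
  note si' = si[THEN square_integrable_sym_grad] si[THEN square_integrable_weak_div]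
  have 1: "((\<lambda>s. L2sq ?L (sym_grad \<Omega> (\<eta> s))) has_real_derivative
      2 * (\<integral>x. sym_grad \<Omega> (\<eta> t) x \<bullet> sym_grad \<Omega> w x \<partial>?L))
        (at t within {a..b})"
    using L2sq_bounded_linear_deriv[OF bounded_linear_matrix_sym ev t d] by (simp add: sym_grad_def[abs_def])
  have 2: "((\<lambda>s. L2sq ?L (weak_div \<Omega> (\<eta> s))) has_real_derivative
      2 * (\<integral>x. weak_div \<Omega> (\<eta> t) x * weak_div \<Omega> w x \<partial>?L)) (at t
        within {a..b})"
    using L2sq_bounded_linear_deriv[OF bounded_linear_trace ev t d] by (simp add: weak_div_def[abs_def])
  have "(\<integral>x. solid_stress L1 L2 \<Omega> (\<eta> t) x \<bullet> weak_grad \<Omega> w x \<partial>?L)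
      = 2 * L1 * (\<integral>x. sym_grad \<Omega> (\<eta> t) x \<bullet> sym_grad \<Omega> w x
        \<partial>?L) + L2 * (\<integral>x. weak_div \<Omega> (\<eta> t) x * weak_div \<Omega> w x
          \<partial>?L)"
    unfolding solid_stress_inner
    using square_integrable_inner[OF si'(1,2)] square_integrable_inner[OF si'(3,4)] by simp
  also have "\<dots> = 1 / 2 * (2 * L1 * (2 * (\<integral>x. sym_grad \<Omega> (\<eta> t) x \<bullet>
    sym_grad \<Omega> w x \<partial>?L))
      + L2 * (2 * (\<integral>x. weak_div \<Omega> (\<eta> t) x * weak_div \<Omega> w x
        \<partial>?L)))" by simp
  finally show ?thesis
    unfolding S_normsq_def by (simp only:) (intro DERIV_cmult DERIV_add 1 2)
qed

text \<open>At almost every time the derivative of the energy is acceleration against velocity plus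
  stress against velocity gradient, which integration by parts turns into the power of the traction.
  Absolute continuity then permits integration over the slab.\<close>

lemma solid_energy_balance:
  assumes \<Omega>: "regular_domain \<Omega>" and \<Sigma>: "closed \<Sigma>" "\<Sigma> \<subseteq>
    frontier \<Omega>" and "a < b"
    and S: "solid_subproblem \<Omega> \<Sigma> \<rho> L1 L2 lam a b um \<tau>m \<eta>0 \<eta>d0 \<eta>
      \<eta>d \<tau>"
    and fin: "finite_measure (surface_on \<Sigma>)"
  shows "\<rho> / 2 * L2sq (lebesgue_on \<Omega>) (\<eta>d b) + 1 / 2 * S_normsq L1 L2 \<Omega> (\<eta> b)
    - (\<rho> / 2 * L2sq (lebesgue_on \<Omega>) (\<eta>d a) + 1 / 2 * S_normsq L1 L2 \<Omega> (\<eta> a))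
    = (\<integral>t. (\<integral>x. \<tau> t x \<bullet> \<eta>d t x \<partial>surface_on \<Sigma>)
      \<partial>lebesgue_on {a..b})"
proof (rule abs_continuous_ftc)
  let ?L = "lebesgue_on \<Omega>"
  show "a \<le> b" using \<open>a < b\<close> by simp
  show "abs_continuous dist {a..b} (\<lambda>t. \<rho> / 2 * L2sq ?L (\<eta>d t) + 1 / 2 * S_normsq L1
    L2 \<Omega> (\<eta> t))"
    using S unfolding solid_subproblem_def by (intro abs_continuous_add) auto
  show "integrable (lebesgue_on {a..b}) (\<lambda>t. \<integral>x. \<tau> t x \<bullet> \<eta>d t x
    \<partial>surface_on \<Sigma>)"
    using S fin unfolding solid_subproblem_def by (intro L2_L2_integrable_inner) auto
  have eqs: "solid_equations \<Omega> \<Sigma> \<rho> L1 L2 a b \<eta> \<eta>d \<tau>" using S by (simp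
    add: solid_subproblem_def)
  have H: "H1_with_trace \<Omega> (\<eta> s)" "AE x in surface_on (frontier \<Omega> - \<Sigma>).
    \<eta> s x = 0" if "s \<in> {a..b}" for s
    using eqs that by (auto simp: solid_equations_def)
  have ev: "L2_evolution ?L a b (\<lambda>t. weak_grad \<Omega> (\<eta> t))" "L2_evolution ?L a b \<eta>d"
    using eqs by (auto simp: solid_equations_def)
  have \<Gamma>: "frontier \<Omega> - \<Sigma> \<in> sets borel" using \<Sigma>(1) by (intro sets.Diff
    borel_closed) auto
  have "AE t in lebesgue_on {a..b}.
        H1_with_trace \<Omega> (\<eta>d t) \<and>
        has_L2_deriv ?L \<eta> (\<eta>d t) (at t within {a..b}) t \<and>
        has_L2_deriv ?L (\<lambda>s. weak_grad \<Omega> (\<eta> s)) (weak_grad \<Omega> (\<eta>d t))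
          (at t within {a..b}) t \<and>
        (\<exists>acc. has_L2_deriv ?L \<eta>d acc (at t within {a..b}) t \<and>
           has_weak_tensor_div \<Omega> (solid_stress L1 L2 \<Omega> (\<eta> t)) (\<lambda>x. \<rho>
             *\<^sub>R acc x) \<and>
           has_normal_trace \<Omega> \<Sigma> (solid_stress L1 L2 \<Omega> (\<eta> t)) (\<lambda>x.
             \<rho> *\<^sub>R acc x) (\<tau> t))"
    using eqs unfolding solid_equations_def by blast
  then show "AE t in lebesgue_on {a..b}. ((\<lambda>t. \<rho> / 2 * L2sq ?L (\<eta>d t) + 1 / 2 *
    S_normsq L1 L2 \<Omega> (\<eta> t))
      has_real_derivative (\<integral>x. \<tau> t x \<bullet> \<eta>d t x \<partial>surface_on
        \<Sigma>)) (at t within {a..b})"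
    using AE_space
  proof eventually_elim
    case (elim t)
    then have t: "t \<in> {a..b}" by simp
    from elim obtain acc where acc: "has_L2_deriv ?L \<eta>d acc (at t within {a..b}) t"
        "has_normal_trace \<Omega> \<Sigma> (solid_stress L1 L2 \<Omega> (\<eta> t)) (\<lambda>x.
          \<rho> *\<^sub>R acc x) (\<tau> t)" by blast
    from elim have w: "H1_with_trace \<Omega> (\<eta>d t)" "has_L2_deriv ?L \<eta> (\<eta>d t) (at t
      within {a..b}) t"
        "has_L2_deriv ?L (\<lambda>s. weak_grad \<Omega> (\<eta> s)) (weak_grad \<Omega> (\<eta>d t))
          (at t within {a..b}) t" by auto
    \<comment> \<open>The boundary condition is imposed on the displacement, whereas the test field
      is the velocity.\<close>
    have "AE x in surface_on (frontier \<Omega> - \<Sigma>). \<eta>d t x = 0"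
      using trace_of_time_derivative_eq_0[OF \<Omega> \<Gamma> Diff_subset \<open>a < b\<close> t H w] .
    from integration_by_parts[OF \<Omega> \<Sigma> w(1) this acc(2)]
    \<comment> \<open>The shape \<open>\<rho> / 2 * (2 * ...)\<close> is the one that
      differentiating the kinetic energy produces.\<close>
    have "\<rho> / 2 * (2 * (\<integral>x. \<eta>d t x \<bullet> acc x \<partial>?L)) + (\<integral>x.
      solid_stress L1 L2 \<Omega> (\<eta> t) x \<bullet> weak_grad \<Omega> (\<eta>d t) x \<partial>?L)
      = (\<integral>x. \<tau> t x \<bullet> \<eta>d t x \<partial>surface_on \<Sigma>)"
      by (simp add: inner_commute)
    moreover have "((\<lambda>t. \<rho> / 2 * L2sq ?L (\<eta>d t) + 1 / 2 * S_normsq L1 L2 \<Omega>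
      (\<eta> t)) has_real_derivative
        \<rho> / 2 * (2 * (\<integral>x. \<eta>d t x \<bullet> acc x \<partial>?L)) + (\<integral>x.
          solid_stress L1 L2 \<Omega> (\<eta> t) x \<bullet> weak_grad \<Omega> (\<eta>d t) x \<partial>?L))
        (at t within {a..b})"
      by (intro DERIV_add DERIV_cmult L2sq_deriv ev t acc S_normsq_deriv w)
    ultimately show ?case by simp
  qed
qed

text \<open>As for the solid, except that the velocity itself carries the boundary condition and the
  stress contributes dissipation instead of stored energy.\<close>

lemma fluid_energy_balance:
  assumes \<Omega>: "regular_domain \<Omega>" and \<Sigma>: "closed \<Sigma>" "\<Sigma> \<subseteq>
    frontier \<Omega>" and "a < b"
    and S: "fluid_subproblem \<Omega> \<Sigma> \<rho> \<mu> lam a b w \<tau>m u0 u p \<tau>"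
    and fin: "finite_measure (surface_on \<Sigma>)"
  shows "\<rho> / 2 * L2sq (lebesgue_on \<Omega>) (u b) - \<rho> / 2 * L2sq (lebesgue_on \<Omega>) (u a)
    = (\<integral>t. (\<integral>x. \<tau> t x \<bullet> u t x \<partial>surface_on \<Sigma>)
      \<partial>lebesgue_on {a..b})
      - 2 * \<mu> * (\<integral>t. L2sq (lebesgue_on \<Omega>) (sym_grad \<Omega> (u t))
        \<partial>lebesgue_on {a..b})"
proof -
  let ?L = "lebesgue_on \<Omega>"
  have i1: "integrable (lebesgue_on {a..b}) (\<lambda>t. \<integral>x. \<tau> t x \<bullet> u t x
    \<partial>surface_on \<Sigma>)"
    using S fin unfolding fluid_subproblem_def by (intro L2_L2_integrable_inner) auto
  have i2: "integrable (lebesgue_on {a..b}) (\<lambda>t. L2sq ?L (sym_grad \<Omega> (u t)))"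
    using S unfolding fluid_subproblem_def by auto
  have eqs: "fluid_equations \<Omega> \<Sigma> \<rho> \<mu> a b u p \<tau>" using S by (simp add:
    fluid_subproblem_def)
  have "\<rho> / 2 * L2sq ?L (u b) - \<rho> / 2 * L2sq ?L (u a) =
     (\<integral>t. (\<integral>x. \<tau> t x \<bullet> u t x \<partial>surface_on \<Sigma>) - 2 *
       \<mu> * L2sq ?L (sym_grad \<Omega> (u t)) \<partial>lebesgue_on {a..b})"
  proof (rule abs_continuous_ftc)
    show "a \<le> b" using \<open>a < b\<close> by simp
    show "abs_continuous dist {a..b} (\<lambda>t. \<rho> / 2 * L2sq ?L (u t))"
      using S unfolding fluid_subproblem_def by auto
    show "integrable (lebesgue_on {a..b}) (\<lambda>t. (\<integral>x. \<tau> t x \<bullet> u t x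
      \<partial>surface_on \<Sigma>) - 2 * \<mu> * L2sq ?L (sym_grad \<Omega> (u t)))"
      using i1 i2 by simp
    have ev: "L2_evolution ?L a b u" using eqs by (simp add: fluid_equations_def)
    have "AE t in lebesgue_on {a..b}.
        H1_with_trace \<Omega> (u t) \<and>
        square_integrable ?L (p t) \<and>
        (AE x in ?L. weak_div \<Omega> (u t) x = 0) \<and>
        (AE x in surface_on (frontier \<Omega> - \<Sigma>). u t x = 0) \<and>
        (\<exists>acc. has_L2_deriv ?L u acc (at t within {a..b}) t \<and>
           has_weak_tensor_div \<Omega> (fluid_stress \<mu> \<Omega> (u t) (p t)) (\<lambda>x. \<rho>
             *\<^sub>R acc x) \<and>
           has_normal_trace \<Omega> \<Sigma> (fluid_stress \<mu> \<Omega> (u t) (p t)) (\<lambda>x.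
             \<rho> *\<^sub>R acc x) (\<tau> t))"
      using eqs by (simp add: fluid_equations_def)
    then show "AE t in lebesgue_on {a..b}. ((\<lambda>t. \<rho> / 2 * L2sq ?L (u t)) has_real_derivative
        (\<integral>x. \<tau> t x \<bullet> u t x \<partial>surface_on \<Sigma>) - 2 * \<mu> * L2sq ?L
          (sym_grad \<Omega> (u t))) (at t within {a..b})"
      using AE_space
    proof eventually_elim
      case (elim t)
      then have t: "t \<in> {a..b}" by simp
      from elim obtain acc where acc: "has_L2_deriv ?L u acc (at t within {a..b}) t"
          "has_normal_trace \<Omega> \<Sigma> (fluid_stress \<mu> \<Omega> (u t) (p t)) (\<lambda>x.
            \<rho> *\<^sub>R acc x) (\<tau> t)" by blast
      from elim have u: "H1_with_trace \<Omega> (u t)" "AE x in surface_on (frontier \<Omega> -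
        \<Sigma>). u t x = 0"
          and p: "square_integrable ?L (p t)" "AE x in ?L. weak_div \<Omega> (u t) x = 0" by auto
      note g = H1_with_trace_square_integrable(2)[OF u(1)]
      have "(\<integral>x. fluid_stress \<mu> \<Omega> (u t) (p t) x \<bullet> weak_grad \<Omega> (u t)
        x \<partial>?L)
          = 2 * \<mu> * L2sq ?L (sym_grad \<Omega> (u t)) - (\<integral>x. p t x * weak_div \<Omega> (u
            t) x \<partial>?L)"
        unfolding fluid_stress_inner L2sq_inner
        using square_integrable_inner[OF square_integrable_sym_grad square_integrable_sym_grad, OF g g]
          square_integrable_inner[OF p(1) square_integrable_weak_div[OF g]]
        by simp
      \<comment> \<open>By incompressibility the pressure does no work.\<close>
      also have "(\<integral>x. p t x * weak_div \<Omega> (u t) x \<partial>?L) = 0"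
        using p(2) by (intro integral_eq_zero_AE) auto
      finally have "\<rho> / 2 * (2 * (\<integral>x. u t x \<bullet> acc x \<partial>?L))
         = (\<integral>x. \<tau> t x \<bullet> u t x \<partial>surface_on \<Sigma>) - 2 * \<mu> * L2sq
           ?L (sym_grad \<Omega> (u t))"
        using integration_by_parts[OF \<Omega> \<Sigma> u acc(2)] by (simp add: inner_commute)
      moreover have "((\<lambda>t. \<rho> / 2 * L2sq ?L (u t)) has_real_derivative
          \<rho> / 2 * (2 * (\<integral>x. u t x \<bullet> acc x \<partial>?L))) (at t within {a..b})"
        by (intro DERIV_cmult L2sq_deriv ev t acc)
      ultimately show ?case by simp
    qed
  qed
  then show ?thesis using i1 i2 by simp
qed

text \<open>The solid condition gives \<open>\<tau>s = lam (um - v) - \<tau>m\<close>, so by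
  polarization \<open>\<tau>s \<bullet> v = lam / 2 * (|um|^2 - |v|^2 - |v - um|^2) - \<tau>m
  \<bullet> v\<close>. Taking squared norms of both sides of the fluid condition gives
  \<open>\<tau>f \<bullet> u = lam / 2 * (|v|^2 - |u|^2) + 1 / (2 * lam) * (|\<tau>m|^2 -
  |\<tau>f|^2) + \<tau>m \<bullet> v\<close>. In the sum, \<open>|v|^2\<close> and
  \<open>\<tau>m \<bullet> v\<close> cancel, because both conditions contain the same
  \<open>v\<close> and the same \<open>\<tau>m\<close>.\<close>

lemma interface_power:
  fixes v u um \<tau>s \<tau>f \<tau>m :: "'b::real_inner"
  assumes "lam > 0" and s: "lam *\<^sub>R v + \<tau>s = lam *\<^sub>R um - \<tau>m" and f: "lam
    *\<^sub>R u + \<tau>f = lam *\<^sub>R v + \<tau>m"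
  shows "\<tau>s \<bullet> v + \<tau>f \<bullet> u = lam / 2 * (um \<bullet> um) + 1 / (2 * lam) *
    (\<tau>m \<bullet> \<tau>m)
     - (lam / 2 * (u \<bullet> u) + 1 / (2 * lam) * (\<tau>f \<bullet> \<tau>f) + lam / 2 * ((v - um)
       \<bullet> (v - um)))"
proof -
  have 1: "\<tau>s = lam *\<^sub>R um - \<tau>m - lam *\<^sub>R v" using s by (simp add: algebra_simps)
  have 2: "\<tau>f = lam *\<^sub>R v + \<tau>m - lam *\<^sub>R u" using f by (simp add: algebra_simps)
  show ?thesis unfolding 1 2 using \<open>lam > 0\<close>
    by (simp add: inner_simps inner_commute field_simps)
qed

text \<open>Kept as an identity for arbitrary data \<open>um\<close>, \<open>\<tau>m\<close> that do
  not depend on time: it then covers the first slab, with exact initial data, as well as the later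
  ones, with averages, and leaves the estimate of the data terms for later.\<close>

lemma slab_balance:
  assumes \<Omega>s: "regular_domain \<Omega>s" and \<Omega>f: "regular_domain \<Omega>f" and \<Sigma>:
    "\<Sigma> = frontier \<Omega>s \<inter> frontier \<Omega>f"
    and "lam > 0" "a < b"
    and solid: "solid_subproblem \<Omega>s \<Sigma> \<rho>s L1 L2 lam a b um \<tau>m \<eta>0 \<eta>d0
      \<eta> \<eta>d \<tau>s"
    and fluid: "fluid_subproblem \<Omega>f \<Sigma> \<rho>f \<mu> lam a b \<eta>d \<tau>m u0 u p \<tau>f"
    and um: "square_integrable (surface_on \<Sigma>) um" and \<tau>m: "square_integrable (surface_on
      \<Sigma>) \<tau>m"
  shows "\<rho>f / 2 * L2sq (lebesgue_on \<Omega>f) (u b) + \<rho>s / 2 * L2sq (lebesgue_on \<Omega>s)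
    (\<eta>d b)
       + 1 / 2 * S_normsq L1 L2 \<Omega>s (\<eta> b)
       + (2 * \<mu> * (\<integral>s. L2sq (lebesgue_on \<Omega>f) (sym_grad \<Omega>f (u s))
         \<partial>lebesgue_on {a..b})
         + lam / 2 * (\<integral>s. L2sq (surface_on \<Sigma>) (\<lambda>x. \<eta>d s x - um x)
           \<partial>lebesgue_on {a..b}))
       + (1 / (2 * lam) * (\<integral>s. L2sq (surface_on \<Sigma>) (\<tau>f s) \<partial>lebesgue_on {a..b})
         + lam / 2 * (\<integral>s. L2sq (surface_on \<Sigma>) (u s) \<partial>lebesgue_on {a..b}))
     = \<rho>f / 2 * L2sq (lebesgue_on \<Omega>f) (u a) + \<rho>s / 2 * L2sq (lebesgue_on \<Omega>s)
       (\<eta>d a)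
       + 1 / 2 * S_normsq L1 L2 \<Omega>s (\<eta> a)
       + (1 / (2 * lam) * ((b - a) * L2sq (surface_on \<Sigma>) \<tau>m) + lam / 2 * ((b - a) * L2sq
         (surface_on \<Sigma>) um))"
proof -
  let ?M = "surface_on \<Sigma>" and ?I = "lebesgue_on {a..b}"
  have cl: "closed \<Sigma>" and sub: "\<Sigma> \<subseteq> frontier \<Omega>s" "\<Sigma> \<subseteq>
    frontier \<Omega>f" by (auto simp: \<Sigma>)
  have borel: "\<Sigma> \<in> sets borel" "frontier \<Omega>s \<in> sets borel" using cl by (auto
    intro: borel_closed)
  have fin: "finite_measure ?M"
    unfolding surface_on_subset[OF borel sub(1)]
    by (rule finite_measure_restrict_space[OF regular_domain_frontier(2)[OF \<Omega>s]])
       (rule borel_in_sets_surface_on[OF borel sub(1)])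
  have L: "L2_L2 ?M a b \<eta>d" "L2_L2 ?M a b \<tau>s" "L2_L2 ?M a b u" "L2_L2 ?M a b \<tau>f"
    and bs: "AE t in ?I. AE x in ?M. lam *\<^sub>R \<eta>d t x + \<tau>s t x = lam *\<^sub>R um x - \<tau>m x"
    and bf: "AE t in ?I. AE x in ?M. lam *\<^sub>R u t x + \<tau>f t x = lam *\<^sub>R \<eta>d t x +
      \<tau>m x"
    using solid fluid by (simp_all add: solid_subproblem_def fluid_subproblem_def)
  have Ld: "L2_L2 ?M a b (\<lambda>t x. \<eta>d t x - um x)"
    using L2_L2_diff[OF L(1) L2_L2_const[OF fin um]] .
  have ints: "integrable ?I (\<lambda>t. \<integral>x. \<tau>s t x \<bullet> \<eta>d t x \<partial>?M)"
    "integrable ?I (\<lambda>t. \<integral>x. \<tau>f t x \<bullet> u t x \<partial>?M)"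
    "integrable ?I (\<lambda>t. L2sq ?M (u t))" "integrable ?I (\<lambda>t. L2sq ?M (\<tau>f t))"
    "integrable ?I (\<lambda>t. L2sq ?M (\<lambda>x. \<eta>d t x - um x))"
    by (intro L2_L2_integrable_inner L2_L2_integrable_L2sq fin L Ld)+
  interpret I: finite_measure ?I by (rule finite_measure_lebesgue_on_Icc)
  \<comment> \<open>The contribution of the data; it is constant in time and so integrates to
    \<open>(b - a) * c\<close>.\<close>
  define c where "c = lam / 2 * L2sq ?M um + 1 / (2 * lam) * L2sq ?M \<tau>m"
  have "AE t in ?I. (\<integral>x. \<tau>s t x \<bullet> \<eta>d t x \<partial>?M) + (\<integral>x.
    \<tau>f t x \<bullet> u t x \<partial>?M)
     = c - (lam / 2 * L2sq ?M (u t) + 1 / (2 * lam) * L2sq ?M (\<tau>f t) + lam / 2 * L2sq ?M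
       (\<lambda>x. \<eta>d t x - um x))"
    using bs bf L[THEN L2_L2_AE_square_integrable[OF fin]]
  proof eventually_elim
    case (elim t)
    note si = elim(3-6)
    have d: "square_integrable ?M (\<lambda>x. \<eta>d t x - um x)" by (rule square_integrable_diff[OF
      si(1) um])
    note int = square_integrable_inner[OF si(2) si(1)] square_integrable_inner[OF si(4) si(3)]
      square_integrable_inner[OF um um] square_integrable_inner[OF \<tau>m \<tau>m]
      square_integrable_inner[OF si(3) si(3)] square_integrable_inner[OF si(4) si(4)]
        square_integrable_inner[OF d d]
    have "(\<integral>x. \<tau>s t x \<bullet> \<eta>d t x \<partial>?M) + (\<integral>x. \<tau>f t x
      \<bullet> u t x \<partial>?M) = (\<integral>x. \<tau>s t x \<bullet> \<eta>d t x + \<tau>f t x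
        \<bullet> u t x \<partial>?M)"
      using int by simp
    also have "\<dots> = (\<integral>x. lam / 2 * (um x \<bullet> um x) + 1 / (2 * lam) * (\<tau>m x
      \<bullet> \<tau>m x)
       - (lam / 2 * (u t x \<bullet> u t x) + 1 / (2 * lam) * (\<tau>f t x \<bullet> \<tau>f t x)
          + lam / 2 * ((\<eta>d t x - um x) \<bullet> (\<eta>d t x - um x))) \<partial>?M)"
    proof (rule complete_measure.integral_AE_eq[OF complete_measure_surface_on[OF borel(1)]])
      show "AE x in ?M. \<tau>s t x \<bullet> \<eta>d t x + \<tau>f t x \<bullet> u t x = lam / 2 * (um
        x \<bullet> um x) + 1 / (2 * lam) * (\<tau>m x \<bullet> \<tau>m x)
       - (lam / 2 * (u t x \<bullet> u t x) + 1 / (2 * lam) * (\<tau>f t x \<bullet> \<tau>f t x)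
          + lam / 2 * ((\<eta>d t x - um x) \<bullet> (\<eta>d t x - um x)))"
        using elim(1,2) by eventually_elim (rule interface_power[OF \<open>lam > 0\<close>])
    qed
    also have "\<dots> = c - (lam / 2 * L2sq ?M (u t) + 1 / (2 * lam) * L2sq ?M (\<tau>f t) + lam / 2 *
      L2sq ?M (\<lambda>x. \<eta>d t x - um x))"
      unfolding c_def L2sq_inner using int by simp
    finally show ?case .
  qed
  then have "(\<integral>t. (\<integral>x. \<tau>s t x \<bullet> \<eta>d t x \<partial>?M) +
    (\<integral>x. \<tau>f t x \<bullet> u t x \<partial>?M) \<partial>?I)
     = (\<integral>t. c - (lam / 2 * L2sq ?M (u t) + 1 / (2 * lam) * L2sq ?M (\<tau>f t) + lam / 2 *
       L2sq ?M (\<lambda>x. \<eta>d t x - um x)) \<partial>?I)"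
    by (rule complete_measure.integral_AE_eq[OF complete_measure_lebesgue_on, rotated]) simp
  also have "\<dots> = (b - a) * c - (lam / 2 * (\<integral>t. L2sq ?M (u t) \<partial>?I) + 1 / (2 *
    lam) * (\<integral>t. L2sq ?M (\<tau>f t) \<partial>?I)
      + lam / 2 * (\<integral>t. L2sq ?M (\<lambda>x. \<eta>d t x - um x) \<partial>?I))"
    using ints measure_lebesgue_on_Icc[of a b] \<open>a < b\<close> by simp
  finally have "(\<integral>t. (\<integral>x. \<tau>s t x \<bullet> \<eta>d t x \<partial>?M)
    \<partial>?I) + (\<integral>t. (\<integral>x. \<tau>f t x \<bullet> u t x \<partial>?M) \<partial>?I)
    = (b - a) * c - (lam / 2 * (\<integral>t. L2sq ?M (u t) \<partial>?I) + 1 / (2 * lam) *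
      (\<integral>t. L2sq ?M (\<tau>f t) \<partial>?I)
      + lam / 2 * (\<integral>t. L2sq ?M (\<lambda>x. \<eta>d t x - um x) \<partial>?I))"
    using ints by simp
  moreover have "(b - a) * c = 1 / (2 * lam) * ((b - a) * L2sq ?M \<tau>m) + lam / 2 * ((b - a) * L2sq ?M um)"
    by (simp only: c_def distrib_left mult.left_commute add.commute)
  ultimately show ?thesis
    using solid_energy_balance[OF \<Omega>s cl sub(1) \<open>a < b\<close> solid fin]
      fluid_energy_balance[OF \<Omega>f cl sub(2) \<open>a < b\<close> fluid fin] by linarith
qed

section \<open>Passage from single slabs to the whole time interval\<close>

lemma
  assumes "finite_measure M" "L2_L2 M ((real n - 1) * \<Delta>t) (real n * \<Delta>t) (g n)" "n
    \<noteq> 0" "\<Delta>t > 0"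
  shows square_integrable_slab_mean: "square_integrable M (slab_mean \<Delta>t g n)"
    and L2sq_slab_mean_le: "\<Delta>t * L2sq M (slab_mean \<Delta>t g n)
      \<le> (\<integral>s. L2sq M (g n s) \<partial>lebesgue_on {(real n - 1) * \<Delta>t .. real n *
        \<Delta>t})"
proof -
  have len: "real n * \<Delta>t - (real n - 1) * \<Delta>t = \<Delta>t" by (simp add: algebra_simps)
  have lt: "(real n - 1) * \<Delta>t < real n * \<Delta>t" using \<open>\<Delta>t > 0\<close> by simp
  have eq: "slab_mean \<Delta>t g n = (\<lambda>x. (1 / \<Delta>t) *\<^sub>R
      (\<integral>s. g n s x \<partial>lebesgue_on {(real n - 1) * \<Delta>t .. real n * \<Delta>t}))"
    using \<open>n \<noteq> 0\<close> by (simp add: slab_mean_def fun_eq_iff)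
  show "square_integrable M (slab_mean \<Delta>t g n)"
    using square_integrable_time_mean[OF assms(1,2) lt] unfolding eq len .
  show "\<Delta>t * L2sq M (slab_mean \<Delta>t g n)
      \<le> (\<integral>s. L2sq M (g n s) \<partial>lebesgue_on {(real n - 1) * \<Delta>t .. real n *
        \<Delta>t})"
    using L2sq_time_mean_le[OF assms(1,2) lt] unfolding eq len .
qed

theorem theorem4p1:
  fixes \<Omega>s \<Omega>f :: "(real^'d) set"
    and \<rho>s \<rho>f \<mu> L1 L2 lam \<Delta>t T :: real
    and N :: nat
    and U E Ed \<tau>S \<tau>F :: "real \<Rightarrow> real^'d \<Rightarrow> real^'d"
    and P :: "real \<Rightarrow> real^'d \<Rightarrow> real"
    and \<eta> \<eta>d u \<tau>s \<tau>f :: "nat \<Rightarrow> real \<Rightarrow> real^'d \<Rightarrow> real^'d"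
    and p :: "nat \<Rightarrow> real \<Rightarrow> real^'d \<Rightarrow> real"
  defines "\<Sigma> \<equiv> frontier \<Omega>s \<inter> frontier \<Omega>f"
  defines "t \<equiv> \<lambda>n::nat. real n * \<Delta>t"
  defines "En \<equiv> \<lambda>n::nat.
           \<rho>f / 2 * L2sq (lebesgue_on \<Omega>f) (u n (t n))
         + \<rho>s / 2 * L2sq (lebesgue_on \<Omega>s) (\<eta>d n (t n))
         + 1 / 2 * S_normsq L1 L2 \<Omega>s (\<eta> n (t n))"
  defines "Tn \<equiv> \<lambda>n::nat.
           2 * \<mu> * (\<integral>s. L2sq (lebesgue_on \<Omega>f) (sym_grad \<Omega>f (u n s)) \<partial>lebesgue_on {t (n - 1)..t n})
         + lam / 2 * (\<integral>s. L2sq (surface_on \<Sigma>) (\<lambda>x. \<eta>d n s x - slab_mean \<Delta>t u (n - 1) x)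
                        \<partial>lebesgue_on {t (n - 1)..t n})"
  defines "Sn \<equiv> \<lambda>n::nat.
           1 / (2 * lam) * (\<integral>s. L2sq (surface_on \<Sigma>) (\<tau>f n s) \<partial>lebesgue_on {t (n - 1)..t n})
         + lam / 2 * (\<integral>s. L2sq (surface_on \<Sigma>) (u n s) \<partial>lebesgue_on {t (n - 1)..t n})"
  defines "S0 \<equiv> \<Delta>t / (2 * lam) * L2sq (surface_on \<Sigma>) (\<tau>F 0)
            + lam * \<Delta>t / 2 * L2sq (surface_on \<Sigma>) (U 0)"
  assumes "regular_domain \<Omega>s" and "regular_domain \<Omega>f" and "\<Omega>s \<inter> \<Omega>f = {}"
    and "\<rho>s > 0" and "\<rho>f > 0" and "\<mu> > 0" and "L1 > 0" and "L2 \<ge> 0"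
    and "lam > 0" and "N \<ge> 1" and "\<Delta>t > 0" and "T = real N * \<Delta>t"
    and exact: "coupled_solution \<Omega>s \<Omega>f \<rho>s \<rho>f \<mu> L1 L2 T U P E Ed \<tau>S \<tau>F"
    and init_solid: "AE x in lebesgue_on \<Omega>s. \<eta> 0 0 x = E 0 x \<and> \<eta>d 0 0 x = Ed 0 x"
    and init_fluid: "AE x in lebesgue_on \<Omega>f. u 0 0 x = U 0 x"
    and init_interface: "AE x in surface_on \<Sigma>. u 0 0 x = U 0 x \<and> \<tau>f 0 0 x = \<tau>F 0 x"
    and solid: "\<And>n. n < N \<Longrightarrow>
           solid_subproblem \<Omega>s \<Sigma> \<rho>s L1 L2 lam (t n) (t (n + 1))
             (slab_mean \<Delta>t u n) (slab_mean \<Delta>t \<tau>f n) (\<eta> n (t n)) (\<eta>d n (t n))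
             (\<eta> (n + 1)) (\<eta>d (n + 1)) (\<tau>s (n + 1))"
    and fluid: "\<And>n. n < N \<Longrightarrow>
           fluid_subproblem \<Omega>f \<Sigma> \<rho>f \<mu> lam (t n) (t (n + 1))
             (\<eta>d (n + 1)) (slab_mean \<Delta>t \<tau>f n) (u n (t n))
             (u (n + 1)) (p (n + 1)) (\<tau>f (n + 1))"
  shows "En N + (\<Sum>n = 1..N. Tn n) + Sn N \<le> En 0 + S0"
proof -
  let ?M = "surface_on \<Sigma>"
  \<comment> \<open>\<open>Sn 0\<close> would integrate over a single instant and vanish; the
    recursion has to start from \<open>S0\<close>.\<close>
  define S where "S n = (if n = 0 then S0 else Sn n)" for n
  have op: "open \<Omega>s" "open \<Omega>f" using assms by (auto simp: regular_domain_def)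
  have cl: "closed \<Sigma>" and sub: "\<Sigma> \<subseteq> frontier \<Omega>s" "\<Sigma> \<subseteq>
    frontier \<Omega>f" by (auto simp: \<Sigma>_def)
  have borel: "\<Sigma> \<in> sets borel" "frontier \<Omega>s \<in> sets borel" "frontier \<Omega>f
    \<in> sets borel"
    using cl by (auto intro: borel_closed)
  have fin: "finite_measure ?M"
    unfolding surface_on_subset[OF borel(1,2) sub(1)]
    by (rule finite_measure_restrict_space[OF regular_domain_frontier(2)[OF \<open>regular_domain
      \<Omega>s\<close>]])
       (rule borel_in_sets_surface_on[OF borel(1,2) sub(1)])
  interpret M: complete_measure ?M by (rule complete_measure_surface_on[OF borel(1)])
  interpret Ls: complete_measure "lebesgue_on \<Omega>s" using op by (intro complete_measure_lebesgue_on) auto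
  interpret Lf: complete_measure "lebesgue_on \<Omega>f" using op by (intro complete_measure_lebesgue_on) auto

  \<comment> \<open>The exact solution supplies square integrable interface values at the initial
    time; those of \<open>u 0 0\<close> and \<open>\<tau>f 0 0\<close> follow by equality almost
    everywhere.\<close>
  have U0: "square_integrable ?M (U 0)"
    using exact H1_with_trace_square_integrable(3)[of \<Omega>f "U 0"]
    unfolding surface_on_subset[OF borel(1,3) sub(2)] coupled_solution_def Let_def
    by (auto intro: square_integrable_restrict_space borel_in_sets_surface_on[OF borel(1,3) sub(2)])
  have \<tau>F0: "square_integrable ?M (\<tau>F 0)"
    using exact unfolding coupled_solution_def Let_def has_normal_trace_def L2_converges_def
      \<Sigma>_def by blast
  have u0: "AE x in ?M. U 0 x = u 0 0 x" and \<tau>0: "AE x in ?M. \<tau>F 0 x = \<tau>f 0 0 x"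
    using init_interface by auto
  have slab0: "slab_mean \<Delta>t g 0 = g 0 0" for g :: "nat \<Rightarrow> real \<Rightarrow> real^'d
    \<Rightarrow> real^'d"
    by (simp add: slab_mean_def fun_eq_iff)

  have means: "square_integrable ?M (slab_mean \<Delta>t u n)" "square_integrable ?M (slab_mean
    \<Delta>t \<tau>f n)"
    "1 / (2 * lam) * (\<Delta>t * L2sq ?M (slab_mean \<Delta>t \<tau>f n)) + lam / 2 * (\<Delta>t *
      L2sq ?M (slab_mean \<Delta>t u n)) \<le> S n"
    if "n \<le> N" for n
  proof -
    have "square_integrable ?M (slab_mean \<Delta>t u n) \<and> square_integrable ?M (slab_mean
      \<Delta>t \<tau>f n) \<and>
      1 / (2 * lam) * (\<Delta>t * L2sq ?M (slab_mean \<Delta>t \<tau>f n)) + lam / 2 * (\<Delta>t *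
        L2sq ?M (slab_mean \<Delta>t u n)) \<le> S n"
    proof (cases "n = 0")
      case True
      \<comment> \<open>The data of the first slab are the initial values themselves, so the bound
        is an equality here.\<close>
      then show ?thesis
        using M.square_integrable_AE_eq[OF U0 u0] M.square_integrable_AE_eq[OF \<tau>F0 \<tau>0]
          M.L2sq_AE_eq[OF u0] M.L2sq_AE_eq[OF \<tau>0]
        by (simp add: slab0 S_def S0_def)
    next
      case False
      then obtain k where k: "n = Suc k" "k < N" using \<open>n \<le> N\<close> by (cases n) auto
      have L: "L2_L2 ?M ((real n - 1) * \<Delta>t) (real n * \<Delta>t) (u n)" "L2_L2 ?M ((real n - 1)
        * \<Delta>t) (real n * \<Delta>t) (\<tau>f n)"
        using fluid[OF k(2)] by (simp_all add: fluid_subproblem_def k(1) t_def)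
      \<comment> \<open>The truncated \<open>n - 1\<close> on naturals agrees with the real
        subtraction because \<open>n\<close> is a successor.\<close>
      have t: "t (n - 1) = (real n - 1) * \<Delta>t" "t n = real n * \<Delta>t" by (simp_all add: t_def k(1))
      have "1 / (2 * lam) * (\<Delta>t * L2sq ?M (slab_mean \<Delta>t \<tau>f n)) + lam / 2 *
        (\<Delta>t * L2sq ?M (slab_mean \<Delta>t u n)) \<le> Sn n"
        unfolding Sn_def t using \<open>lam > 0\<close> False \<open>\<Delta>t > 0\<close>
        by (intro add_mono mult_left_mono L2sq_slab_mean_le fin L) auto
      then show ?thesis
        using False \<open>\<Delta>t > 0\<close> by (auto simp: S_def intro!:
          square_integrable_slab_mean fin L)
    qed
    then show "square_integrable ?M (slab_mean \<Delta>t u n)" "square_integrable ?M (slab_mean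
      \<Delta>t \<tau>f n)"
      "1 / (2 * lam) * (\<Delta>t * L2sq ?M (slab_mean \<Delta>t \<tau>f n)) + lam / 2 * (\<Delta>t *
        L2sq ?M (slab_mean \<Delta>t u n)) \<le> S n"
      by blast+
  qed

  have step: "En (Suc n) + Tn (Suc n) + S (Suc n) \<le> En n + S n" if "n < N" for n
  proof -
    have len: "t (n + 1) - t n = \<Delta>t" and lt: "t n < t (n + 1)"
      using \<open>\<Delta>t > 0\<close> by (simp_all add: t_def algebra_simps)
    note so = solid[OF that] and fl = fluid[OF that]
    have \<eta>0: "AE x in lebesgue_on \<Omega>s. \<eta> (n + 1) (t n) x = \<eta> n (t n) x"
      and \<eta>d0: "AE x in lebesgue_on \<Omega>s. \<eta>d (n + 1) (t n) x = \<eta>d n (t n) x"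
      and u0: "AE x in lebesgue_on \<Omega>f. u (n + 1) (t n) x = u n (t n) x"
      using so fl by (simp_all add: solid_subproblem_def fluid_subproblem_def)
    \<comment> \<open>The balance on the slab starts from the fields with index \<open>n + 1\<close>
      at time \<open>t n\<close>, whereas \<open>En n\<close> is built from those with index
      \<open>n\<close>. The two states agree almost everywhere, which suffices for every term of the
      energy.\<close>
    have "En (n + 1) + Tn (n + 1) + Sn (n + 1) = En n
       + (1 / (2 * lam) * (\<Delta>t * L2sq ?M (slab_mean \<Delta>t \<tau>f n)) + lam / 2 * (\<Delta>t
         * L2sq ?M (slab_mean \<Delta>t u n)))"
      using slab_balance[OF \<open>regular_domain \<Omega>s\<close> \<open>regular_domain
        \<Omega>f\<close> \<Sigma>_def[THEN meta_eq_to_obj_eq] \<open>lam > 0\<close> lt so fl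
          means(1,2)] that
      unfolding En_def Tn_def Sn_def len Ls.L2sq_AE_eq[OF \<eta>d0] Lf.L2sq_AE_eq[OF u0]
        S_normsq_AE_eq[OF op(1) \<eta>0]
      by simp
    then show ?thesis using means(3)[of n] that by (simp add: S_def)
  qed
  have "En n + (\<Sum>k = 1..n. Tn k) + S n \<le> En 0 + S0" if "n \<le> N" for n
    using that
  proof (induction n)
    case 0
    then show ?case by (simp add: S_def)
  next
    case (Suc n)
    then show ?case using step[of n] by simp
  qed
  \<comment> \<open>\<open>N \<ge> 1\<close> makes \<open>S N\<close> the interface term
    \<open>Sn N\<close> and not the initial \<open>S0\<close>.\<close>
  from this[of N] show ?thesis using \<open>N \<ge> 1\<close> by (simp add: S_def)
qed

end
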